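(* Let $k$ be an infinite field, $R=k[x_1,\ldots,x_m]$ and $I\subsetneq R$ a homogeneous ideal. For any linear map $\lambda:\mathbb Z^m\to\mathbb Z$ we have $$r(R/I)\le r(R/\operatorname{in}_\lambda(I)).$$
   Context: For a standard graded $k$-algebra $A$, a reduction of $A$ is an ideal $Q$ generated by linear forms (elements of $A_1$) such that $Q_n=A_n$ for all large $n$. The reduction number $r_Q(A)$ of $A$ with respect to $Q$ is the least $n\ge0$ with $Q_{n+1}=A_{n+1}$. A reduction is minimal if it contains no other reduction (equivalently, it is a reduction generated by $\dim A$ linear forms). The reduction number is $r(A)=\min\{r_Q(A)\mid Q\text{ a minimal reduction of }A\}$. The map $\lambda$ assigns to a monomial $x^a=x_1^{a_1}\cdots x_m^{a_m}$ the weight $\lambda(x^a)=\lambda(a_1,\ldots,a_m)$. For $0\ne f\in R$, $\operatorname{in}_\lambda(f)$ is the sum of those terms of $f$ whose monomials have maximal weight among the monomials occurring in $f$. $\operatorname{in}_\lambda(I)$ is the ideal generated by all $\operatorname{in}_\lambda(f)$, $0\ne f\in I$; it is homogeneous with respect to the standard grading. *)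

theory Defs
  imports
    "HOL-Algebra.Algebraic_Closure_Type"
    "HOL-Analysis.Finite_Cartesian_Product"
    "HOL-Library.Poly_Mapping"
begin

section \<open>Reductions and reduction numbers of graded algebras\<close>

text \<open>
  A graded ring is given by the ring \<open>A\<close> and the family \<open>G\<close> of its homogeneous components
  (\<open>G n\<close> is the component of degree \<open>n\<close>). An ideal \<open>Q\<close> generated by elements of \<open>G 1\<close> is a
  homogeneous ideal, so its component of degree \<open>n\<close> is \<open>Q \<inter> G n\<close>.
\<close>

definition is_reduction :: "('a, 'b) ring_scheme \<Rightarrow> (nat \<Rightarrow> 'a set) \<Rightarrow> 'a set \<Rightarrow> bool" where
  "is_reduction A G Q \<longleftrightarrow>
     (\<exists>L. L \<subseteq> G 1 \<and> Q = Idl\<^bsub>A\<^esub> L) \<and> (\<exists>N. \<forall>n\<ge>N. Q \<inter> G n = G n)"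

definition is_minimal_reduction ::
    "('a, 'b) ring_scheme \<Rightarrow> (nat \<Rightarrow> 'a set) \<Rightarrow> 'a set \<Rightarrow> bool" where
  "is_minimal_reduction A G Q \<longleftrightarrow>
     is_reduction A G Q \<and> (\<forall>Q'. is_reduction A G Q' \<and> Q' \<subseteq> Q \<longrightarrow> Q' = Q)"

definition reduction_number_wrt :: "(nat \<Rightarrow> 'a set) \<Rightarrow> 'a set \<Rightarrow> nat" where
  "reduction_number_wrt G Q = (LEAST n. Q \<inter> G (n + 1) = G (n + 1))"

text \<open>
  \<open>Inf\<close> is the minimum of a nonempty set of natural numbers. In a standard graded algebra over a
  field the set is nonempty: the ideal generated by \<open>G 1\<close> is a reduction, and every reduction
  contains a minimal one since \<open>G 1\<close> is finite dimensional.
\<close>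

definition reduction_number :: "('a, 'b) ring_scheme \<Rightarrow> (nat \<Rightarrow> 'a set) \<Rightarrow> nat" where
  "reduction_number A G = Inf {reduction_number_wrt G Q | Q. is_minimal_reduction A G Q}"


section \<open>Polynomial rings and their standard graded quotients\<close>

text \<open>
  Polynomials over \<open>'k\<close> in the variables \<open>x\<^sub>i\<close>, \<open>i\<close> ranging over the finite type \<open>'m\<close>: a monomial
  is its exponent function, a polynomial is the finitely supported function of its coefficients,
  and multiplication is convolution.
\<close>

type_synonym ('m, 'k) mpoly = "('m \<Rightarrow>\<^sub>0 nat) \<Rightarrow>\<^sub>0 'k"

abbreviation mpoly_ring :: "('m::finite, 'k::field) mpoly ring" where
  "mpoly_ring \<equiv> ring_of_type_algebra"

definition monom_degree :: "('m::finite \<Rightarrow>\<^sub>0 nat) \<Rightarrow> nat" where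
  "monom_degree a = (\<Sum>i\<in>UNIV. Poly_Mapping.lookup a i)"

definition homogeneous_of_degree :: "nat \<Rightarrow> ('m::finite, 'k::field) mpoly \<Rightarrow> bool" where
  "homogeneous_of_degree d f \<longleftrightarrow> (\<forall>a\<in>Poly_Mapping.keys f. monom_degree a = d)"

definition homogeneous_ideal :: "('m::finite, 'k::field) mpoly set \<Rightarrow> bool" where
  "homogeneous_ideal I \<longleftrightarrow>
     (\<exists>S. (\<forall>f\<in>S. \<exists>d. homogeneous_of_degree d f) \<and> I = Idl\<^bsub>mpoly_ring\<^esub> S)"

definition quotient_grading ::
    "('m::finite, 'k::field) mpoly set \<Rightarrow> nat \<Rightarrow> ('m, 'k) mpoly set set" where
  "quotient_grading J n = {J +>\<^bsub>mpoly_ring\<^esub> f | f. homogeneous_of_degree n f}"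

definition quotient_reduction_number :: "('m::finite, 'k::field) mpoly set \<Rightarrow> nat" where
  "quotient_reduction_number J = reduction_number (mpoly_ring Quot J) (quotient_grading J)"


section \<open>Initial ideals with respect to a weight\<close>

definition weight :: "(int ^ 'm \<Rightarrow> int) \<Rightarrow> ('m::finite \<Rightarrow>\<^sub>0 nat) \<Rightarrow> int" where
  "weight lam a = lam (\<chi> i. int (Poly_Mapping.lookup a i))"

definition initial_form ::
    "(int ^ 'm \<Rightarrow> int) \<Rightarrow> ('m::finite, 'k::field) mpoly \<Rightarrow> ('m, 'k) mpoly" where
  "initial_form lam f =
     (\<Sum>a \<in> {a \<in> Poly_Mapping.keys f. weight lam a = Max (weight lam ` Poly_Mapping.keys f)}.
        Poly_Mapping.single a (Poly_Mapping.lookup f a))"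

definition initial_ideal ::
    "(int ^ 'm \<Rightarrow> int) \<Rightarrow> ('m::finite, 'k::field) mpoly set \<Rightarrow> ('m, 'k) mpoly set" where
  "initial_ideal lam I = Idl\<^bsub>mpoly_ring\<^esub> {initial_form lam f | f. f \<in> I \<and> f \<noteq> 0}"

end

theory Submission
  imports Defs "Jordan_Normal_Form.Determinant"
begin

text \<open>
  Let \<open>J\<close> be the initial ideal and let \<open>L\<close> be a smallest set of linear forms generating a minimal
  reduction of \<open>R/J\<close> that attains the reduction number \<open>r\<close>. For \<open>t \<noteq> 0\<close> let \<open>\<phi>\<^sub>t\<close> scale each monomial
  by \<open>t\<close> to the power of its weight. Since \<open>J\<close> is the limit at \<open>t = 0\<close> of the ideals
  \<open>\<phi>\<^sub>t\<^sup>-\<^sup>1(I)\<close>, expressing the monomials of degree \<open>r + 1\<close> through \<open>J + (L)\<close> gives a polynomial matrix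
  in \<open>t\<close> that is the identity at \<open>t = 0\<close>; it is invertible for some \<open>t \<noteq> 0\<close>, so the forms
  \<open>\<phi>\<^sub>t(L)\<close> generate a reduction of \<open>R/I\<close> of reduction number at most \<open>r\<close>.

  This reduction is minimal because no reduction of \<open>R/I\<close> is generated by fewer than \<open>card L\<close>
  linear forms. Otherwise the Hilbert function of \<open>R/I\<close>, which bounds that of \<open>R/J\<close>, would grow
  too slowly for the power products of \<open>L\<close> to be linearly independent modulo \<open>J\<close>. Over an infinite
  field a homogeneous relation among them can be made monic in one of the forms by a linear change
  of the others, which makes that form superfluous and contradicts the minimality of \<open>L\<close>.
\<close>

section \<open>Linear algebra and counting\<close>

text \<open>Gaussian elimination modulo \<open>W\<close>: each induction step removes one generator
  from \<open>T\<close> and one index from \<open>Y\<close>. The vectors form a family, so a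
  coincidence of two of them already counts as a relation.\<close>

lemma (in vector_space) dependent_modulo_subspace:
  assumes "finite T" "finite Y" "card T < card Y" "subspace W"
    and "\<And>x. x \<in> Y \<Longrightarrow> b x \<in> span (W \<union> T)"
  shows "\<exists>c. (\<exists>x\<in>Y. c x \<noteq> 0) \<and> (\<Sum>x\<in>Y. scale (c x) (b x)) \<in> W"
  using assms
proof (induction T arbitrary: Y b rule: finite_induct)
  case empty
  then obtain x0 where x0: "x0 \<in> Y" by fastforce
  have sW: "span W = W" using empty.prems by simp
  have "(\<Sum>x\<in>Y. scale (if x = x0 then 1 else 0) (b x)) = b x0"
    using empty.prems x0 by (simp add: if_distrib[of "\<lambda>c. scale c _"] cong: if_cong)
  moreover have "b x0 \<in> W" using empty.prems x0 sW by auto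
  ultimately show ?case using x0 by (intro exI[of _ "\<lambda>x. if x = x0 then 1 else 0"]) auto
next
  case (insert t T)
  have "\<forall>x\<in>Y. \<exists>a. b x - scale a t \<in> span (W \<union> T)"
    using insert.prems(4) span_breakdown_eq[of _ t "W \<union> T"] by auto
  then obtain a where a: "\<And>x. x \<in> Y \<Longrightarrow> b x - scale (a x) t \<in> span (W \<union> T)" by metis
  show ?case
  proof (cases "\<forall>x\<in>Y. a x = 0")
    case True
    then have "\<And>x. x \<in> Y \<Longrightarrow> b x \<in> span (W \<union> T)" using a by fastforce
    moreover have "card T < card Y" using insert by auto
    ultimately show ?thesis using insert by blast
  next
    case False
    then obtain x0 where x0: "x0 \<in> Y" "a x0 \<noteq> 0" by blast
    \<comment> \<open>Pivoting on \<open>x0\<close> cancels the coefficient of \<open>t\<close> in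
      all other vectors.\<close>
    define b' where "b' x = b x - scale (a x / a x0) (b x0)" for x
    have b': "b' x \<in> span (W \<union> T)" if "x \<in> Y - {x0}" for x
    proof -
      have "b' x = (b x - scale (a x) t) - scale (a x / a x0) (b x0 - scale (a x0) t)"
        using x0 by (simp add: b'_def scale_right_diff_distrib)
      also have "\<dots> \<in> span (W \<union> T)"
        by (rule span_diff[OF a span_scale[OF a]]) (use that x0 in auto)
      finally show ?thesis .
    qed
    have "card T < card (Y - {x0})" using insert x0 by auto
    then obtain c where c: "\<exists>x\<in>Y - {x0}. c x \<noteq> 0"
        "(\<Sum>x\<in>Y - {x0}. scale (c x) (b' x)) \<in> W"
      using insert.IH[of "Y - {x0}" b'] insert.prems b' by auto
    \<comment> \<open>The coefficient at \<open>x0\<close> collects the multiples of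
      \<open>b x0\<close> that were subtracted in \<open>b'\<close>.\<close>
    define c' where "c' = c(x0 := - (\<Sum>x\<in>Y - {x0}. c x * (a x / a x0)))"
    have "(\<Sum>x\<in>Y. scale (c' x) (b x))
        = scale (c' x0) (b x0) + (\<Sum>x\<in>Y - {x0}. scale (c' x) (b x))"
      using insert.prems x0 by (simp add: sum.remove)
    also have "(\<Sum>x\<in>Y - {x0}. scale (c' x) (b x)) = (\<Sum>x\<in>Y - {x0}. scale (c x) (b x))"
      by (intro sum.cong) (auto simp: c'_def)
    also have "scale (c' x0) (b x0) + \<dots> = (\<Sum>x\<in>Y - {x0}. scale (c x) (b' x))"
      by (simp add: c'_def b'_def scale_right_diff_distrib sum_subtractf scale_sum_left)
    finally show ?thesis using c by (intro exI[of _ c']) (auto simp: c'_def)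
  qed
qed

text \<open>A vector of \<open>S\<close> outside the span of \<open>B\<close> would extend
  \<open>B\<close> to an independent set in \<open>span S\<close> with more than
  \<open>card S\<close> elements.\<close>

lemma (in vector_space) subset_span_of_card_le:
  assumes "independent B" "B \<subseteq> span S" "finite S" "card S \<le> card B"
  shows "S \<subseteq> span B"
proof -
  have "v \<in> span B" if v: "v \<in> S" for v
  proof (rule ccontr)
    assume nv: "v \<notin> span B"
    then have "v \<notin> B" using span_base by blast
    have "independent (insert v B)" using nv assms(1) by (rule independent_insertI)
    moreover have "insert v B \<subseteq> span S" using assms(2) v span_base by blast
    ultimately have "finite (insert v B) \<and> card (insert v B) \<le> card S"
      by (rule independent_span_bound[OF assms(3)])
    then show False using assms(4) \<open>v \<notin> B\<close> by auto
  qed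
  then show ?thesis by blast
qed

text \<open>The determinant of \<open>G\<close> is a polynomial in \<open>t\<close> with value 1 at
  0, so it has finitely many roots, and an infinite field has a nonzero \<open>t\<close> at which
  the matrix is invertible. The coefficients \<open>c\<close> are a row of the inverse.\<close>

lemma perturbed_identity_solvable:
  fixes G :: "'a \<Rightarrow> 'a \<Rightarrow> 'k::field poly"
  assumes inf: "infinite (UNIV :: 'k set)" and fin: "finite M"
    and G0: "\<And>a b. a \<in> M \<Longrightarrow> b \<in> M \<Longrightarrow> poly (G a b) 0 = (if a = b then 1 else 0)"
  shows "\<exists>t. t \<noteq> 0 \<and> (\<forall>b\<in>M. \<exists>c. \<forall>b'\<in>M.
    (\<Sum>a\<in>M. c a * poly (G a b') t) = (if b = b' then 1 else 0))"
proof -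
  define n where "n = card M"
  obtain e where e: "bij_betw e {0..<n} M" using ex_bij_betw_nat_finite[OF fin] n_def by blast
  have eM: "\<And>i. i < n \<Longrightarrow> e i \<in> M" using e by (auto simp: bij_betw_def)
  have einj: "\<And>i j. i < n \<Longrightarrow> j < n \<Longrightarrow> e i = e j \<longleftrightarrow> i = j"
    using e by (auto simp: bij_betw_def inj_on_def)
  define A where "A = mat n n (\<lambda>(i, j). G (e i) (e j))"
  have A: "A \<in> carrier_mat n n" by (simp add: A_def)
  interpret ev: comm_ring_hom "\<lambda>p. poly p (x :: 'k)" for x by unfold_locales auto
  have "map_mat (\<lambda>p. poly p 0) A = 1\<^sub>m n"
    by (rule eq_matI) (auto simp: A_def G0 eM einj)
  then have "poly (det A) 0 = 1" using ev.hom_det[of 0 A] by simp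
  then have "det A \<noteq> 0" by auto
  then have "finite {t. poly (det A) t = 0}" by (rule poly_roots_finite)
  then have "finite (insert 0 {t. poly (det A) t = 0})" by simp
  then obtain t where t: "t \<noteq> 0" "poly (det A) t \<noteq> 0"
    using inf ex_new_if_finite[of "insert 0 {t. poly (det A) t = 0}"] by auto
  have "\<exists>c. \<forall>b'\<in>M. (\<Sum>a\<in>M. c a * poly (G a b') t) = (if b = b' then 1 else 0)" if b: "b \<in> M" for b
  proof -
    obtain k where k: "k < n" "b = e k" using b e by (auto simp: bij_betw_def)
    define ei where "ei = inv_into {0..<n} e"
    \<comment> \<open>Row \<open>k\<close> of the adjugate divided by the determinant;
      \<open>ei\<close> translates elements of \<open>M\<close> back to indices.\<close>
    define c where "c a = poly (adj_mat A $$ (k, ei a)) t / poly (det A) t" for a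
    have "(\<Sum>a\<in>M. c a * poly (G a b') t) = (if b = b' then 1 else 0)" if b': "b' \<in> M" for b'
    proof -
      obtain k' where k': "k' < n" "b' = e k'" using b' e by (auto simp: bij_betw_def)
      have eie: "\<And>i. i < n \<Longrightarrow> ei (e i) = i"
        using e by (auto simp: ei_def bij_betw_def)
      have "(adj_mat A * A) $$ (k, k') = (\<Sum>i = 0..<n. adj_mat A $$ (k, i) * A $$ (i, k'))"
        using A adj_mat(1)[OF A] k k' by (auto simp: scalar_prod_def)
      then have *: "(\<Sum>i = 0..<n. adj_mat A $$ (k, i) * A $$ (i, k')) = (if k = k' then det A else 0)"
        using adj_mat(3)[OF A] k k' by (auto split: if_splits)
      have "(\<Sum>a\<in>M. c a * poly (G a b') t) = (\<Sum>i = 0..<n. c (e i) * poly (G (e i) b') t)"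
        by (rule sum.reindex_bij_betw[OF e, symmetric])
      also have "\<dots> = (\<Sum>i = 0..<n. poly (adj_mat A $$ (k, i) * A $$ (i, k')) t) / poly (det A) t"
        using k' by (simp add: c_def eie A_def sum_divide_distrib)
      also have "\<dots> = poly (if k = k' then det A else 0) t / poly (det A) t"
        by (simp add: *[symmetric] poly_sum)
      also have "\<dots> = (if b = b' then 1 else 0)" using t k k' einj by auto
      finally show ?thesis .
    qed
    then show ?thesis by blast
  qed
  then show ?thesis using t by blast
qed

section \<open>Power products and points where a polynomial does not vanish\<close>

definition power_list :: "'a::comm_monoid_mult list \<Rightarrow> nat list \<Rightarrow> 'a" where
  "power_list xs bs = prod_list (map2 (^) xs bs)"

lemma power_list_simps [simp]:
  "power_list [] bs = 1" "power_list xs [] = 1"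
  "power_list (x # xs) (b # bs) = x ^ b * power_list xs bs"
  by (simp_all add: power_list_def)

text \<open>\<open>B\<close> and \<open>c\<close> encode a nonzero polynomial in \<open>d\<close>
  variables. The induction first fixes all coordinates but the first one, in such a way that a
  nonzero polynomial in the first variable remains.\<close>

lemma exists_power_list_nonroot:
  fixes c :: "nat list \<Rightarrow> 'k::field"
  assumes inf: "infinite (UNIV :: 'k set)" and "finite B" "\<And>\<beta>. \<beta> \<in> B \<Longrightarrow> length \<beta> = d"
    and "\<exists>\<beta>\<in>B. c \<beta> \<noteq> 0"
  shows "\<exists>u. length u = d \<and> (\<Sum>\<beta>\<in>B. c \<beta> * power_list u \<beta>) \<noteq> 0"
  using assms(2-)
proof (induction d arbitrary: B c)
  case 0
  then have "B = {[]}" by auto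
  then show ?case using 0 by auto
next
  case (Suc d)
  obtain \<beta>0 where \<beta>0: "\<beta>0 \<in> B" "c \<beta>0 \<noteq> 0" using Suc.prems by blast
  then obtain b0 \<gamma>0 where b0: "\<beta>0 = b0 # \<gamma>0" using Suc.prems(2) by (metis length_Suc_conv)
  \<comment> \<open>The exponents of the coefficient of the power \<open>b0\<close> of the first
    variable, a polynomial in the remaining variables; it is nonzero because of
    \<open>\<beta>0\<close>.\<close>
  define B' where "B' = {\<gamma>. b0 # \<gamma> \<in> B}"
  have B': "Cons b0 ` B' = {\<beta> \<in> B. hd \<beta> = b0}"
    using Suc.prems(2) by (auto simp: B'_def image_iff) (metis length_Suc_conv list.sel(1))
  have finB': "finite B'"
    using Suc.prems(1) unfolding B'_def by (rule finite_vimageI[of B "Cons b0", unfolded vimage_def]) simp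
  have "\<And>\<gamma>. \<gamma> \<in> B' \<Longrightarrow> length \<gamma> = d" "\<exists>\<gamma>\<in>B'. c (b0 # \<gamma>) \<noteq> 0"
    using Suc.prems(2)[of "b0 # _"] \<beta>0 b0 by (auto simp: B'_def)
  from Suc.IH[OF finB' this]
  obtain u where u: "length u = d" "(\<Sum>\<gamma>\<in>B'. c (b0 # \<gamma>) * power_list u \<gamma>) \<noteq> 0"
    by blast
  \<comment> \<open>The polynomial with the remaining variables evaluated at \<open>u\<close>; its
    coefficient at \<open>b0\<close> is the nonzero value found above.\<close>
  define P where "P = (\<Sum>\<beta>\<in>B. monom (c \<beta> * power_list u (tl \<beta>)) (hd \<beta>))"
  have "coeff P b0 = (\<Sum>\<beta>\<in>B. if hd \<beta> = b0 then c \<beta> * power_list u (tl \<beta>) else 0)"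
    by (simp add: P_def coeff_sum)
  also have "\<dots> = (\<Sum>\<beta>\<in>Cons b0 ` B'. c \<beta> * power_list u (tl \<beta>))"
    unfolding B' using Suc.prems(1) by (simp add: sum.inter_filter)
  also have "\<dots> = (\<Sum>\<gamma>\<in>B'. c (b0 # \<gamma>) * power_list u \<gamma>)"
    by (subst sum.reindex) auto
  finally have "P \<noteq> 0" using u by auto
  then have "finite {x. poly P x = 0}" by (rule poly_roots_finite)
  then obtain x where x: "poly P x \<noteq> 0"
    using inf ex_new_if_finite by blast
  have "poly P x = (\<Sum>\<beta>\<in>B. c \<beta> * power_list (x # u) \<beta>)"
    unfolding P_def poly_sum
  proof (rule sum.cong[OF refl])
    fix \<beta> assume "\<beta> \<in> B"
    then obtain b \<gamma> where "\<beta> = b # \<gamma>" using Suc.prems(2) by (metis length_Suc_conv)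
    then show "poly (monom (c \<beta> * power_list u (tl \<beta>)) (hd \<beta>)) x = c \<beta> * power_list (x # u) \<beta>"
      by (simp add: poly_monom)
  qed
  then show ?case using x u by (intro exI[of _ "x # u"]) auto
qed

section \<open>The number of exponent vectors of given degree\<close>

definition exponents :: "nat \<Rightarrow> nat \<Rightarrow> nat list set" where
  "exponents d n = {\<beta>. length \<beta> = d \<and> sum_list \<beta> = n}"

lemma card_exponents: "card (exponents d n) = (n + d - 1) choose n"
  unfolding exponents_def by (rule card_length_sum_list)

lemma finite_exponents [simp]: "finite (exponents d n)"
proof (rule finite_subset)
  show "exponents d n \<subseteq> {\<beta>. set \<beta> \<subseteq> {..n} \<and> length \<beta> = d}"
    by (auto simp: exponents_def intro: member_le_sum_list)
qed (rule finite_lists_length_eq, simp)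

text \<open>For \<open>d > 0\<close> the count is a polynomial of degree \<open>d - 1\<close> in the
  sum of the exponents, so one more variable wins against any constant factor.\<close>

lemma card_exponents_growth:
  "\<exists>n>s. C * card (exponents d (n - s)) < card (exponents (Suc d) n)"
proof (cases d)
  case 0
  \<comment> \<open>In positive degree there is no exponent vector of length 0, so the left side
    vanishes.\<close>
  then show ?thesis by (intro exI[of _ "Suc s"]) (simp add: card_exponents)
next
  case (Suc e)
  \<comment> \<open>Large enough that \<open>C * Suc e < Suc (n + e)\<close>, the ratio needed in
    the absorption identity for binomial coefficients below.\<close>
  define n where "n = C * Suc e + s + 1"
  have c1: "card (exponents d k) = (k + e) choose e" for k
    using Suc binomial_symmetric[of k "k + e"] by (simp add: card_exponents)
  have c2: "card (exponents (Suc d) n) = (Suc (n + e)) choose (Suc e)"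
    using Suc binomial_symmetric[of n "Suc (n + e)"] by (simp add: card_exponents)
  have pos: "(n + e) choose e > 0" by simp
  have "Suc e * (C * card (exponents d (n - s))) \<le> Suc e * (C * ((n + e) choose e))"
    unfolding c1 by (intro mult_le_mono le_refl binomial_right_mono add_right_mono) simp
  also have "\<dots> = (C * Suc e) * ((n + e) choose e)" by (simp only: ac_simps)
  also have "\<dots> < Suc (n + e) * ((n + e) choose e)"
    using pos by (intro mult_strict_right_mono) (auto simp: n_def)
  also have "\<dots> = Suc e * (Suc (n + e) choose Suc e)" by (rule Suc_times_binomial[symmetric])
  finally have "C * card (exponents d (n - s)) < card (exponents (Suc d) n)"
    unfolding c2 by (simp only: mult_less_cancel1)
  then show ?thesis by (intro exI[of _ n]) (simp add: n_def)
qed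

section \<open>Monomials and homogeneous components\<close>

abbreviation (input) lookup where "lookup \<equiv> Poly_Mapping.lookup"
abbreviation (input) keys where "keys \<equiv> Poly_Mapping.keys"
abbreviation (input) single where "single \<equiv> Poly_Mapping.single"

text \<open>A ring is a module over itself: \<open>idl.subspace\<close> says ideal, and
  \<open>idl.span\<close> is the generated ideal. The interpretation \<open>vs\<close> that follows
  lets only constants act, so \<open>vs.span\<close> is the linear span over the field.\<close>

interpretation idl: Modules.module "(*) :: 'a::comm_ring_1 \<Rightarrow> 'a \<Rightarrow> 'a"
  by unfold_locales (simp_all add: algebra_simps)

interpretation vs: Vector_Spaces.vector_space
  "\<lambda>c (f :: 'a::comm_monoid_add \<Rightarrow>\<^sub>0 'k::field). Poly_Mapping.single 0 c * f"
  by unfold_locales (simp_all add: distrib_left distrib_right single_add mult_single flip: mult.assoc)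

lemma lookup_single_mult_add [simp]:
  fixes f :: "'a::cancel_comm_monoid_add \<Rightarrow>\<^sub>0 'k::semiring_0"
  shows "lookup (single a c * f) (a + b) = c * lookup f b"
  by (simp add: lookup_mult lookup_single when_mult)

lemma lookup_const_mult [simp]:
  fixes f :: "'a::cancel_comm_monoid_add \<Rightarrow>\<^sub>0 'k::semiring_0"
  shows "lookup (single 0 c * f) b = c * lookup f b"
  using lookup_single_mult_add[of 0 c f b] by simp

lemma lookup_single_mult_eq_0:
  fixes f :: "'a::cancel_comm_monoid_add \<Rightarrow>\<^sub>0 'k::semiring_0"
  assumes "\<And>b'. b \<noteq> a + b'"
  shows "lookup (single a c * f) b = 0"
proof -
  have "b \<notin> keys (single a c * f)"
    using keys_mult[of "single a c" f] assms by (auto split: if_splits)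
  then show ?thesis by (simp add: in_keys_iff)
qed

lemma poly_mapping_sum_singles:
  "f = (\<Sum>a\<in>keys f. single a (lookup f a))"
  by (rule poly_mapping_eqI) (simp add: lookup_sum lookup_single when_def in_keys_iff)

lemma poly_mapping_induct [case_names zero single add]:
  assumes "P 0" "\<And>a c. P (single a c)" "\<And>f g. P f \<Longrightarrow> P g \<Longrightarrow> P (f + g)"
  shows "P (f :: 'a \<Rightarrow>\<^sub>0 'b::comm_monoid_add)"
proof -
  have "P (\<Sum>a\<in>A. single a (lookup f a))" if "finite A" for A
    using that by induction (auto intro: assms)
  from this[of "keys f"] show ?thesis by (simp flip: poly_mapping_sum_singles)
qed

text \<open>Every polynomial is a sum of terms, so closure under multiplication by single terms
  suffices.\<close>

lemma ideal_subspaceI: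
  fixes S :: "('a::comm_monoid_add \<Rightarrow>\<^sub>0 'k::comm_ring_1) set"
  assumes "0 \<in> S" "\<And>f g. f \<in> S \<Longrightarrow> g \<in> S \<Longrightarrow> f + g \<in> S"
    and "\<And>a c f. f \<in> S \<Longrightarrow> single a c * f \<in> S"
  shows "idl.subspace S"
proof (rule idl.subspaceI)
  fix p f assume "f \<in> S"
  then show "p * f \<in> S"
    by (induction p rule: poly_mapping_induct) (auto simp: distrib_right intro: assms)
qed (use assms in auto)

lemma vs_subspace_of_ideal: "idl.subspace J \<Longrightarrow> vs.subspace J"
  by (auto simp: idl.subspace_def vs.subspace_def)

abbreviation forms :: "nat \<Rightarrow> ('m::finite, 'k::field) mpoly set" where
  "forms n \<equiv> {f. homogeneous_of_degree n f}"

definition monoms :: "nat \<Rightarrow> ('m::finite \<Rightarrow>\<^sub>0 nat) set" where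
  "monoms n = {a. monom_degree a = n}"

lemma monom_degree_0 [simp]: "monom_degree 0 = 0"
  by (simp add: monom_degree_def)

lemma monom_degree_add [simp]: "monom_degree (a + b) = monom_degree a + monom_degree b"
  by (simp add: monom_degree_def lookup_add sum.distrib)

lemma monom_degree_single [simp]: "monom_degree (single i k) = k"
  by (simp add: monom_degree_def lookup_single when_def)

lemma finite_monoms [simp]: "finite (monoms n :: ('m::finite \<Rightarrow>\<^sub>0 nat) set)"
proof (rule finite_imageD)
  show "inj_on lookup (monoms n :: ('m \<Rightarrow>\<^sub>0 nat) set)"
    by (intro inj_onI) (simp only: poly_mapping.lookup_inject)
  have "lookup ` (monoms n :: ('m \<Rightarrow>\<^sub>0 nat) set) \<subseteq> PiE UNIV (\<lambda>_. {..n})"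
    by (auto simp: monoms_def monom_degree_def PiE_def intro: member_le_sum)
  then show "finite (lookup ` (monoms n :: ('m \<Rightarrow>\<^sub>0 nat) set))"
    by (rule finite_subset) (intro finite_PiE; simp)
qed

lemma monom_degree_split:
  "monom_degree a = n + k \<Longrightarrow> \<exists>b c. a = b + c \<and> monom_degree b = n \<and> monom_degree c = k"
proof (induction n arbitrary: a)
  case 0
  then show ?case by (intro exI[of _ 0] exI[of _ a]) auto
next
  case (Suc n)
  then have "(\<Sum>i\<in>UNIV. lookup a i) \<noteq> 0" by (simp add: monom_degree_def)
  then obtain i where i: "lookup a i \<noteq> 0" by (meson sum.neutral)
  have a: "a = single i 1 + (a - single i 1)"
    by (rule poly_mapping_eqI) (use i in \<open>auto simp: lookup_add lookup_minus lookup_single when_def\<close>)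
  then have "monom_degree a = 1 + monom_degree (a - single i 1)"
    by (metis monom_degree_add monom_degree_single)
  then have "monom_degree (a - single i 1) = n + k" using Suc.prems by simp
  from Suc.IH[OF this]
  obtain b c where "a - single i 1 = b + c" "monom_degree b = n" "monom_degree c = k"
    by blast
  then show ?case using a
    by (intro exI[of _ "single i 1 + b"] exI[of _ c]) (auto simp: add.assoc)
qed

lemma forms_zero [simp]: "homogeneous_of_degree n 0"
  by (simp add: homogeneous_of_degree_def)

lemma forms_single [simp]: "homogeneous_of_degree n (single a c) \<longleftrightarrow> c = 0 \<or> monom_degree a = n"
  by (auto simp: homogeneous_of_degree_def)

lemma forms_add: "homogeneous_of_degree n f \<Longrightarrow> homogeneous_of_degree n g \<Longrightarrow>
    homogeneous_of_degree n (f + g)"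
  using keys_add[of f g] by (auto simp: homogeneous_of_degree_def)

lemma forms_mult: "homogeneous_of_degree n f \<Longrightarrow> homogeneous_of_degree k g \<Longrightarrow>
    homogeneous_of_degree (n + k) (f * g)"
  using keys_mult[of f g] by (force simp: homogeneous_of_degree_def)

lemma forms_const_mult:
  "homogeneous_of_degree n f \<Longrightarrow> homogeneous_of_degree n (single 0 c * f)"
  using forms_mult[of 0 "single 0 c" n f] by simp

lemma subspace_forms: "vs.subspace (forms n :: ('m::finite, 'k::field) mpoly set)"
  by (simp add: vs.subspace_def forms_add forms_const_mult)

lemma form_eq_sum_monoms:
  assumes "homogeneous_of_degree n f"
  shows "f = (\<Sum>a\<in>monoms n. single a (lookup f a))"
proof -
  have "keys f \<subseteq> monoms n" using assms by (auto simp: homogeneous_of_degree_def monoms_def)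
  then have "(\<Sum>a\<in>monoms n. single a (lookup f a)) = (\<Sum>a\<in>keys f. single a (lookup f a))"
    by (intro sum.mono_neutral_right) (auto simp: in_keys_iff)
  with poly_mapping_sum_singles[of f] show ?thesis by (rule trans[OF _ sym])
qed

lemma forms_subsetI:
  fixes K :: "('m::finite, 'k::field) mpoly set"
  assumes "vs.subspace K" "\<And>a. monom_degree a = n \<Longrightarrow> single a 1 \<in> K"
  shows "forms n \<subseteq> K"
proof
  fix f :: "('m, 'k) mpoly" assume "f \<in> forms n"
  then have "homogeneous_of_degree n f" by simp
  then have *: "f = (\<Sum>a\<in>monoms n. single a (lookup f a))"
    by (rule form_eq_sum_monoms)
  have "single a (lookup f a) \<in> K" if "a \<in> monoms n" for a
  proof -
    have "single 0 (lookup f a) * single a 1 \<in> K"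
      using that assms by (intro vs.subspace_scale) (auto simp: monoms_def)
    then show ?thesis by (simp add: mult_single)
  qed
  then have "(\<Sum>a\<in>monoms n. single a (lookup f a)) \<in> K"
    by (rule vs.subspace_sum[OF assms(1)])
  with * show "f \<in> K" by (rule ssubst)
qed

section \<open>Homogeneous components and graded ideals\<close>

definition hcomp :: "nat \<Rightarrow> ('m::finite, 'k::field) mpoly \<Rightarrow> ('m, 'k) mpoly" where
  "hcomp n f = Poly_Mapping.mapp (\<lambda>a c. c when monom_degree a = n) f"

lemma lookup_hcomp: "lookup (hcomp n f) a = (if monom_degree a = n then lookup f a else 0)"
  by (auto simp: hcomp_def lookup_mapp when_def in_keys_iff)

lemma forms_hcomp [simp]: "homogeneous_of_degree n (hcomp n f)"
  by (auto simp: homogeneous_of_degree_def in_keys_iff lookup_hcomp split: if_splits)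

lemma hcomp_zero [simp]: "hcomp n 0 = 0"
  by (rule poly_mapping_eqI) (simp add: lookup_hcomp)

lemma hcomp_add: "hcomp n (f + g) = hcomp n f + hcomp n g"
  by (rule poly_mapping_eqI) (simp add: lookup_hcomp lookup_add)

lemma hcomp_form: "homogeneous_of_degree k f \<Longrightarrow> hcomp n f = (if n = k then f else 0)"
  by (rule poly_mapping_eqI)
    (auto simp: lookup_hcomp homogeneous_of_degree_def in_keys_iff)

lemma hcomp_mult_form:
  assumes "homogeneous_of_degree k v"
  shows "hcomp (n + k) (f * v) = hcomp n f * v"
proof (induction f rule: poly_mapping_induct)
  case (single a c)
  have "homogeneous_of_degree (monom_degree a) (single a c)" by simp
  then have "homogeneous_of_degree (monom_degree a + k) (single a c * v)"
    using assms by (rule forms_mult)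
  then show ?case
    by (auto simp: hcomp_form hcomp_form[of "monom_degree a" "single a c"])
qed (auto simp: hcomp_add distrib_right)

lemma hcomp_0_mult_form:
  assumes "homogeneous_of_degree k v" "n < k"
  shows "hcomp n (f * v) = 0"
proof (induction f rule: poly_mapping_induct)
  case (single a c)
  have "homogeneous_of_degree (monom_degree a) (single a c)" by simp
  then have "homogeneous_of_degree (monom_degree a + k) (single a c * v)"
    using assms(1) by (rule forms_mult)
  then show ?case using assms(2) by (auto simp: hcomp_form)
qed (auto simp: hcomp_add distrib_right)

lemma hcomp_single_mult:
  "hcomp n (single a c * f) =
    (if monom_degree a \<le> n then single a c * hcomp (n - monom_degree a) f else 0)"
proof -
  have a: "homogeneous_of_degree (monom_degree a) (single a c)" by simp
  show ?thesis
  proof (cases "monom_degree a \<le> n")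
    case True
    then show ?thesis
      using hcomp_mult_form[OF a, of "n - monom_degree a" f] by (simp add: mult.commute)
  next
    case False
    then show ?thesis using hcomp_0_mult_form[OF a, of n f] by (simp add: mult.commute)
  qed
qed

text \<open>For an ideal this is equivalent to having homogeneous generators; closure under
  components is the form in which homogeneity is used below.\<close>

definition graded :: "('m::finite, 'k::field) mpoly set \<Rightarrow> bool" where
  "graded J \<longleftrightarrow> (\<forall>f\<in>J. \<forall>n. hcomp n f \<in> J)"

text \<open>A component of a term times a generator is zero or the term times a component of the
  generator, so closure passes from \<open>S\<close> to the ideal.\<close>

lemma graded_span:
  assumes "\<And>f n. f \<in> S \<Longrightarrow> hcomp n f \<in> idl.span S"
  shows "graded (idl.span S)"
  unfolding graded_def
proof (intro ballI allI)
  fix f n assume "f \<in> idl.span S"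
  then show "hcomp n f \<in> idl.span S"
  proof (induction arbitrary: n rule: idl.span_induct_alt)
    case base
    then show ?case by (simp add: idl.span_zero)
  next
    case (step p x y)
    have "hcomp n (p * x) \<in> idl.span S" for n
    proof (induction p rule: poly_mapping_induct)
      case (single a c)
      then show ?case using assms[OF step(1)]
        by (auto simp: hcomp_single_mult idl.span_zero intro: idl.span_scale)
    qed (auto simp: hcomp_add distrib_right idl.span_zero intro: idl.span_add)
    then show ?case using step.IH by (auto simp: hcomp_add intro: idl.span_add)
  qed
qed

lemma graded_span_Un_forms:
  assumes "graded J" "V \<subseteq> forms k"
  shows "graded (idl.span (J \<union> V))"
proof (rule graded_span)
  fix f n assume f: "f \<in> J \<union> V"
  then show "hcomp n f \<in> idl.span (J \<union> V)"
  proof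
    assume "f \<in> J"
    then show ?thesis using assms(1) by (auto simp: graded_def intro: idl.span_base)
  next
    assume "f \<in> V"
    then have "homogeneous_of_degree k f" using assms(2) by blast
    then have "hcomp n f \<in> {f, 0}" by (simp add: hcomp_form)
    then show ?thesis using f by (auto intro: idl.span_base idl.span_zero)
  qed
qed

text \<open>In degree \<open>n + 1\<close> a multiple of a linear form only sees the degree
  \<open>n\<close> part of its cofactor. Membership in an ideal thereby becomes membership in a
  linear span, the form needed for dimension counts.\<close>

lemma hcomp_span_Un_linear_forms:
  assumes J: "idl.subspace J" "graded J" and V: "V \<subseteq> forms 1" and f: "f \<in> idl.span (J \<union> V)"
  shows "hcomp (Suc n) f \<in> vs.span (J \<union> {p * v | p v. p \<in> forms n \<and> v \<in> V})"
    (is "_ \<in> vs.span (J \<union> ?P)")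
  using f
proof (induction rule: idl.span_induct_alt)
  case base
  then show ?case by (simp add: vs.span_zero)
next
  case (step p x y)
  have "hcomp (Suc n) (p * x) \<in> J \<union> ?P"
    using step(1)
  proof
    assume "x \<in> J"
    then show ?thesis using J by (auto simp: graded_def idl.subspace_scale)
  next
    assume "x \<in> V"
    moreover from this have "hcomp (Suc n) (p * x) = hcomp n p * x"
      using V hcomp_mult_form[of 1 x n p] by auto
    moreover have "hcomp n p \<in> forms n" by simp
    ultimately show ?thesis by blast
  qed
  then show ?case using step.IH by (auto simp: hcomp_add intro: vs.span_add vs.span_base)
qed

text \<open>A monomial of degree \<open>n'\<close> is a multiple of one of degree \<open>n\<close>.
  Hence a single degree suffices to recognize a reduction.\<close>

lemma forms_subset_mono:
  fixes K :: "('m::finite, 'k::field) mpoly set"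
  assumes "idl.subspace K" "forms n \<subseteq> K" "n \<le> n'"
  shows "forms n' \<subseteq> K"
proof (rule forms_subsetI)
  show "vs.subspace K" using assms(1) by (rule vs_subspace_of_ideal)
  fix a :: "'m \<Rightarrow>\<^sub>0 nat" assume "monom_degree a = n'"
  then obtain b c where "a = b + c" "monom_degree b = n'- n" "monom_degree c = n"
    using monom_degree_split[of a "n' - n" n] assms(3) by auto
  then have "single a 1 = single b 1 * single c (1::'k)" "single c (1::'k) \<in> K"
    using assms(2) by (auto simp: mult_single)
  then show "single a (1::'k) \<in> K" using assms(1) by (metis idl.subspace_scale)
qed

section \<open>Reductions of the quotient ring\<close>

lemma ring_of_type_algebra_simps [simp]:
  "carrier (ring_of_type_algebra :: 'a::ring_1 ring) = UNIV"
  "x \<otimes>\<^bsub>ring_of_type_algebra\<^esub> y = x * (y :: 'a)"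
  "x \<oplus>\<^bsub>ring_of_type_algebra\<^esub> y = x + (y :: 'a)"
  "\<zero>\<^bsub>ring_of_type_algebra\<^esub> = (0 :: 'a)"
  by (simp_all add: ring_of_type_algebra_def)

lemma ideal_ring_of_type_algebra_iff:
  "ideal J (ring_of_type_algebra :: 'a::comm_ring_1 ring) \<longleftrightarrow> idl.subspace J"
proof
  assume "ideal J (ring_of_type_algebra :: 'a ring)"
  then interpret ideal J "ring_of_type_algebra :: 'a ring" .
  show "idl.subspace J"
  proof (rule idl.subspaceI)
    show "0 \<in> J" using additive_subgroup.zero_closed[OF is_additive_subgroup] by simp
    show "x + y \<in> J" if "x \<in> J" "y \<in> J" for x y using additive_subgroup.a_closed[OF is_additive_subgroup that] by simp
    show "c * x \<in> J" if "x \<in> J" for c x using I_l_closed[OF that, of c] by simp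
  qed
next
  assume J: "idl.subspace J"
  interpret R: ring "ring_of_type_algebra :: 'a ring" by (rule ring_from_type_algebra)
  have inv: "inv\<^bsub>add_monoid ring_of_type_algebra\<^esub> x = - x" for x :: 'a
    using R.minus_equality[of "- x" x] by (simp add: a_inv_def)
  show "ideal J (ring_of_type_algebra :: 'a ring)"
  proof (rule idealI[OF R.ring_axioms])
    show "subgroup J (add_monoid (ring_of_type_algebra :: 'a ring))"
    proof (rule subgroup.intro)
      show "inv\<^bsub>add_monoid ring_of_type_algebra\<^esub> x \<in> J" if "x \<in> J" for x
        unfolding inv using J that by (rule idl.subspace_neg)
    qed (use J in \<open>auto simp: idl.subspace_add idl.subspace_0\<close>)
  next
    fix a x :: 'a assume "a \<in> J"
    then have "x * a \<in> J" using J by (rule idl.subspace_scale[rotated])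
    then show "x \<otimes>\<^bsub>ring_of_type_algebra\<^esub> a \<in> J" "a \<otimes>\<^bsub>ring_of_type_algebra\<^esub> x \<in> J"
      by (simp_all only: ring_of_type_algebra_simps mult.commute[of a x])
  qed
qed

lemma genideal_ring_of_type_algebra:
  "Idl\<^bsub>ring_of_type_algebra\<^esub> S = idl.span (S :: 'a::comm_ring_1 set)"
  unfolding genideal_def ideal_ring_of_type_algebra_iff
  using idl.subspace_span[of S] idl.span_superset[of S] idl.span_minimal[of S]
  by blast

section \<open>Ideals of a quotient and ideals containing the kernel\<close>

context
  fixes J :: "'a::comm_ring_1 set"
  assumes J: "idl.subspace J"
begin

interpretation J: ideal J "ring_of_type_algebra :: 'a ring"
  using J by (simp add: ideal_ring_of_type_algebra_iff)

abbreviation (input) proj :: "'a \<Rightarrow> 'a set" where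
  "proj \<equiv> (+>\<^bsub>ring_of_type_algebra\<^esub>) J"

lemma coset_eq_iff: "proj f = proj g \<longleftrightarrow> f - g \<in> J"
proof -
  have mem: "x \<in> proj y \<longleftrightarrow> x - y \<in> J" for x y
    by (force simp: a_r_coset_def' algebra_simps)
  show ?thesis
  proof
    assume "proj f = proj g"
    moreover have "f \<in> proj f" using idl.subspace_0[OF J] by (simp add: mem)
    ultimately show "f - g \<in> J" by (simp add: mem)
  next
    assume *: "f - g \<in> J"
    have "x - f \<in> J \<longleftrightarrow> x - g \<in> J" for x
      using idl.subspace_add[OF J, of "x - f" "f - g"] idl.subspace_diff[OF J, of "x - g" "f - g"] *
      by auto
    then show "proj f = proj g" by (auto simp: mem)
  qed
qed

text \<open>\<open>K\<close> contains \<open>J\<close>, so it is a union of cosets of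
  \<open>J\<close> and can be recovered from its image.\<close>

lemma coset_in_image_iff:
  assumes "idl.subspace K" "J \<subseteq> K"
  shows "proj f \<in> proj ` K \<longleftrightarrow> f \<in> K"
proof
  assume "proj f \<in> proj ` K"
  then obtain g where "g \<in> K" "f - g \<in> J" by (auto simp: coset_eq_iff)
  then show "f \<in> K" using idl.subspace_add[OF assms(1), of "f - g" g] assms(2) by auto
qed auto

text \<open>Correspondence of ideals: the image of an ideal under the projection is an ideal, which
  gives one inclusion; the preimage of the ideal on the left is an ideal containing \<open>J\<close>
  and \<open>V\<close>, which gives the other.\<close>

lemma genideal_quotient:
  "Idl\<^bsub>ring_of_type_algebra Quot J\<^esub> (proj ` V) = proj ` idl.span (J \<union> V)"
proof
  let ?R = "ring_of_type_algebra :: 'a ring"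
  interpret Q: ring "?R Quot J" by (rule J.quotient_is_ring)
  interpret h: ring_hom_ring ?R "?R Quot J" proj by (rule J.rcos_ring_hom_ring)
  have K: "ideal (idl.span (J \<union> V)) ?R" by (simp add: ideal_ring_of_type_algebra_iff)
  have "ideal (proj ` idl.span (J \<union> V)) (?R Quot J)"
    by (rule J.ring_ideal_imp_quot_ideal[OF J.is_ideal K])
  then show "Idl\<^bsub>?R Quot J\<^esub> (proj ` V) \<subseteq> proj ` idl.span (J \<union> V)"
    by (rule Q.genideal_minimal) (auto intro: idl.span_base)
  have car: "proj ` V \<subseteq> carrier (?R Quot J)" using h.hom_closed by auto
  then have I: "ideal (Idl\<^bsub>?R Quot J\<^esub> (proj ` V)) (?R Quot J)"
    by (rule Q.genideal_ideal)
  have "ideal {r \<in> carrier ?R. proj r \<in> Idl\<^bsub>?R Quot J\<^esub> (proj ` V)} ?R"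
    by (rule h.ideal_vimage[OF I])
  then have sub: "idl.subspace {r. proj r \<in> Idl\<^bsub>?R Quot J\<^esub> (proj ` V)}"
    by (simp add: ideal_ring_of_type_algebra_iff)
  have "proj r = \<zero>\<^bsub>?R Quot J\<^esub>" if "r \<in> J" for r
    using that h.hom_zero coset_eq_iff[of r 0] by simp
  moreover have "\<zero>\<^bsub>?R Quot J\<^esub> \<in> Idl\<^bsub>?R Quot J\<^esub> (proj ` V)"
    using I by (simp add: additive_subgroup.zero_closed ideal.axioms(1))
  ultimately have "J \<union> V \<subseteq> {r. proj r \<in> Idl\<^bsub>?R Quot J\<^esub> (proj ` V)}"
    using Q.genideal_self[OF car] by auto
  then have "idl.span (J \<union> V) \<subseteq> {r. proj r \<in> Idl\<^bsub>?R Quot J\<^esub> (proj ` V)}"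
    using sub by (rule idl.span_minimal)
  then show "proj ` idl.span (J \<union> V) \<subseteq> Idl\<^bsub>?R Quot J\<^esub> (proj ` V)" by auto
qed

end

section \<open>Reductions described by linear forms of the polynomial ring\<close>

definition reduces :: "('m::finite, 'k::field) mpoly set \<Rightarrow> bool" where
  "reduces K \<longleftrightarrow> (\<exists>N. \<forall>n\<ge>N. forms n \<subseteq> K)"

text \<open>Different sets of linear forms can describe the same reduction of R/J, so minimality
  compares the ideals \<open>idl.span (J \<union> V)\<close> and not the sets
  \<open>V\<close>.\<close>

definition minimally_reduces ::
    "('m::finite, 'k::field) mpoly set \<Rightarrow> ('m, 'k) mpoly set \<Rightarrow> bool" where
  "minimally_reduces J V \<longleftrightarrow> V \<subseteq> forms 1 \<and> reduces (idl.span (J \<union> V)) \<and>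
    (\<forall>V'\<subseteq>forms 1. reduces (idl.span (J \<union> V')) \<and> idl.span (J \<union> V') \<subseteq> idl.span (J \<union> V) \<longrightarrow>
      idl.span (J \<union> V') = idl.span (J \<union> V))"

lemma reducesI: "idl.subspace K \<Longrightarrow> forms n \<subseteq> K \<Longrightarrow> reduces K"
  unfolding reduces_def using forms_subset_mono by blast

lemma reduces_mono: "reduces K \<Longrightarrow> K \<subseteq> K' \<Longrightarrow> reduces K'"
  unfolding reduces_def by blast

context
  fixes J :: "('m::finite, 'k::field) mpoly set"
  assumes J: "idl.subspace J"
begin

abbreviation (input) pr :: "('m::finite, 'k::field) mpoly \<Rightarrow> ('m, 'k) mpoly set" where
  "pr \<equiv> (+>\<^bsub>mpoly_ring\<^esub>) J"

lemma image_Int_quotient_grading: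
  "pr ` idl.span (J \<union> V) \<inter> quotient_grading J n = quotient_grading J n \<longleftrightarrow>
    forms n \<subseteq> idl.span (J \<union> V)"
proof -
  have "J \<subseteq> idl.span (J \<union> V)" using idl.span_superset by blast
  then have "pr f \<in> pr ` idl.span (J \<union> V) \<longleftrightarrow> f \<in> idl.span (J \<union> V)" for f
    by (intro coset_in_image_iff[OF J]) auto
  then have "pr ` forms n \<subseteq> pr ` idl.span (J \<union> V) \<longleftrightarrow> forms n \<subseteq> idl.span (J \<union> V)"
    by (simp only: image_subset_iff) blast
  moreover have "quotient_grading J n = pr ` forms n"
    by (auto simp: quotient_grading_def)
  ultimately show ?thesis by (simp only: inf.absorb_iff2[symmetric])
qed

lemma is_reduction_quotient_iff:
  "is_reduction (mpoly_ring Quot J) (quotient_grading J) Q \<longleftrightarrow>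
    (\<exists>V\<subseteq>forms 1. Q = pr ` idl.span (J \<union> V) \<and> reduces (idl.span (J \<union> V)))"
proof -
  have gr: "quotient_grading J 1 = pr ` forms 1"
    by (auto simp: quotient_grading_def)
  \<comment> \<open>Every set of classes of linear forms is the image of a set of linear forms, so
    generators can be lifted.\<close>
  have ex: "(\<exists>L\<subseteq>pr ` F. P L) \<longleftrightarrow> (\<exists>V\<subseteq>F. P (pr ` V))" for F P
    unfolding subset_image_iff by blast
  have "(\<exists>L\<subseteq>quotient_grading J 1. Q = Idl\<^bsub>mpoly_ring Quot J\<^esub> L) \<longleftrightarrow>
      (\<exists>V\<subseteq>forms 1. Q = pr ` idl.span (J \<union> V))"
    unfolding gr ex genideal_quotient[OF J] ..
  then have "is_reduction (mpoly_ring Quot J) (quotient_grading J) Q \<longleftrightarrow>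
      (\<exists>V\<subseteq>forms 1. Q = pr ` idl.span (J \<union> V) \<and>
        (\<exists>N. \<forall>n\<ge>N. Q \<inter> quotient_grading J n = quotient_grading J n))"
    unfolding is_reduction_def by (simp only: conj_assoc[symmetric] ex_simps(1))
  also have "\<dots> \<longleftrightarrow> (\<exists>V\<subseteq>forms 1. Q = pr ` idl.span (J \<union> V) \<and> reduces (idl.span (J \<union> V)))"
    unfolding reduces_def
    by (intro ex_cong1 conj_cong refl) (simp only: image_Int_quotient_grading)
  finally show ?thesis .
qed

lemma is_minimal_reduction_quotient_iff:
  "is_minimal_reduction (mpoly_ring Quot J) (quotient_grading J) Q \<longleftrightarrow>
    (\<exists>V. minimally_reduces J V \<and> Q = pr ` idl.span (J \<union> V))"
proof -
  have mem: "pr f \<in> pr ` idl.span (J \<union> V) \<longleftrightarrow> f \<in> idl.span (J \<union> V)" for f V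
    using idl.span_superset[of "J \<union> V"] by (intro coset_in_image_iff[OF J]) auto
  have sub: "pr ` idl.span (J \<union> V) \<subseteq> pr ` idl.span (J \<union> V') \<longleftrightarrow>
      idl.span (J \<union> V) \<subseteq> idl.span (J \<union> V')" for V V'
    by (auto simp: mem image_subset_iff)
  have eq: "pr ` idl.span (J \<union> V) = pr ` idl.span (J \<union> V') \<longleftrightarrow>
      idl.span (J \<union> V) = idl.span (J \<union> V')" for V V'
    unfolding set_eq_subset sub ..
  define P where "P V \<longleftrightarrow> V \<subseteq> forms 1 \<and> reduces (idl.span (J \<union> V))" for V
  define g where "g V = pr ` idl.span (J \<union> V)" for V
  have red: "is_reduction (mpoly_ring Quot J) (quotient_grading J) Q \<longleftrightarrow> (\<exists>V. P V \<and> Q = g V)" for Q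
    unfolding is_reduction_quotient_iff P_def g_def
    by (simp only: conj_assoc conj_commute[of "Q = _"])
  have "is_minimal_reduction (mpoly_ring Quot J) (quotient_grading J) Q \<longleftrightarrow>
      (\<exists>V. (P V \<and> (\<forall>V'. P V' \<and> g V' \<subseteq> g V \<longrightarrow> g V' = g V)) \<and> Q = g V)"
  proof
    assume "is_minimal_reduction (mpoly_ring Quot J) (quotient_grading J) Q"
    then obtain V where V: "P V" "Q = g V"
      and min: "\<And>Q'. (\<exists>V. P V \<and> Q' = g V) \<Longrightarrow> Q' \<subseteq> Q \<Longrightarrow> Q' = Q"
      unfolding is_minimal_reduction_def red by (elim conjE exE) simp
    have "g V' = g V" if "P V'" "g V' \<subseteq> g V" for V'
      using that unfolding V(2)[symmetric] by (intro min exI[of _ V'] conjI refl)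
    then show "\<exists>V. (P V \<and> (\<forall>V'. P V' \<and> g V' \<subseteq> g V \<longrightarrow> g V' = g V)) \<and> Q = g V"
      using V by (intro exI[of _ V]) simp
  next
    assume "\<exists>V. (P V \<and> (\<forall>V'. P V' \<and> g V' \<subseteq> g V \<longrightarrow> g V' = g V)) \<and> Q = g V"
    then obtain V where V: "P V" "Q = g V"
      and min: "\<And>V'. P V' \<Longrightarrow> g V' \<subseteq> g V \<Longrightarrow> g V' = g V"
      by (elim conjE exE) simp
    show "is_minimal_reduction (mpoly_ring Quot J) (quotient_grading J) Q"
      unfolding is_minimal_reduction_def red V(2)
      by (intro conjI allI impI exI[of _ V] refl V(1); elim conjE exE) (simp add: min)
  qed
  also have "\<dots> \<longleftrightarrow> (\<exists>V. minimally_reduces J V \<and> Q = pr ` idl.span (J \<union> V))"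
    unfolding g_def sub eq minimally_reduces_def P_def
    by (simp only: conj_assoc imp_conjL)
  finally show ?thesis .
qed

text \<open>Reduction numbers are now expressed through ideals of the polynomial ring, where the
  rest of the argument takes place.\<close>

lemma quotient_reduction_number_eq:
  "quotient_reduction_number J =
    Inf {LEAST n. forms (n + 1) \<subseteq> idl.span (J \<union> V) | V. minimally_reduces J V}"
proof -
  have *: "{h Q | Q. \<exists>V. P V \<and> Q = g V} = {h (g V) | V. P V}"
    for h :: "'b \<Rightarrow> nat" and g :: "'c \<Rightarrow> 'b" and P
    by blast
  show ?thesis
    unfolding quotient_reduction_number_def reduction_number_def
      is_minimal_reduction_quotient_iff reduction_number_wrt_def *
      image_Int_quotient_grading ..
qed

end

lemma homogeneous_ideal_graded:
  assumes "homogeneous_ideal I"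
  shows "idl.subspace I" "graded I"
proof -
  obtain S where S: "\<forall>f\<in>S. \<exists>d. homogeneous_of_degree d f" "I = idl.span S"
    using assms by (auto simp: homogeneous_ideal_def genideal_ring_of_type_algebra)
  show "idl.subspace I" unfolding S(2) by (rule idl.subspace_span)
  have "hcomp n f \<in> idl.span S" if "f \<in> S" for f n
  proof -
    from bspec[OF S(1) that] obtain d where "homogeneous_of_degree d f" by (rule exE)
    then have "hcomp n f = (if n = d then f else 0)" by (rule hcomp_form)
    then show ?thesis using idl.span_base[OF that] idl.span_zero[of S] by (cases "n = d") simp_all
  qed
  then show "graded I" unfolding S(2) by (rule graded_span)
qed

section \<open>Degeneration to the initial ideal\<close>

text \<open>A common form of two maps: with \<open>h\<close> the identity it is the torus action,
  and with \<open>h\<close> the evaluation at \<open>t\<close> it sends a family over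
  \<open>k[t]\<close> to its member at \<open>t\<close>, moved by the torus.\<close>

definition twist :: "('b \<Rightarrow> 'c) \<Rightarrow> ('a \<Rightarrow> 'c) \<Rightarrow> ('a \<Rightarrow>\<^sub>0 'b::zero) \<Rightarrow> ('a \<Rightarrow>\<^sub>0 'c::semiring_0)" where
  "twist h u f = Poly_Mapping.mapp (\<lambda>a c. u a * h c) f"

context
  fixes h :: "'b::comm_ring_1 \<Rightarrow> 'c::comm_ring_1" and u :: "'a::cancel_comm_monoid_add \<Rightarrow> 'c"
  assumes h: "comm_ring_hom h" and u: "\<And>a b. u (a + b) = u a * u b"
begin

interpretation h: comm_ring_hom h by (rule h)

lemma lookup_twist: "lookup (twist h u f) a = u a * h (lookup f a)"
  by (simp add: twist_def lookup_mapp when_def in_keys_iff)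

lemma twist_zero [simp]: "twist h u 0 = 0"
  by (rule poly_mapping_eqI) (simp add: lookup_twist)

lemma twist_add: "twist h u (f + g) = twist h u f + twist h u g"
  by (rule poly_mapping_eqI) (simp add: lookup_twist lookup_add h.hom_add distrib_left)

text \<open>Multiplicativity of \<open>u\<close> makes the map compatible with multiplication by
  terms, so it can be used in arguments about generated ideals.\<close>

lemma twist_single_mult: "twist h u (single a c * f) = single a (u a * h c) * twist h u f"
proof (rule poly_mapping_eqI)
  fix b
  show "lookup (twist h u (single a c * f)) b = lookup (single a (u a * h c) * twist h u f) b"
  proof (cases "\<exists>b'. b = a + b'")
    case True
    then obtain b' where "b = a + b'" by blast
    show ?thesis
      unfolding \<open>b = a + b'\<close>
      by (simp only: lookup_twist lookup_single_mult_add u h.hom_mult) (simp only: mult_ac)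
  next
    case False
    then have b: "\<And>b'. b \<noteq> a + b'" by blast
    show ?thesis
      by (simp only: lookup_twist lookup_single_mult_eq_0[OF b] h.hom_zero mult_zero_right)
  qed
qed

lemma keys_twist_subset: "keys (twist h u f) \<subseteq> keys f"
  by (auto simp: in_keys_iff lookup_twist)

end

lemma comm_ring_hom_id: "comm_ring_hom (\<lambda>c :: 'k::comm_ring_1. c)"
  by unfold_locales auto

lemma comm_ring_hom_poly: "comm_ring_hom (\<lambda>p. poly p (t :: 'k::comm_ring_1))"
  by unfold_locales auto

section \<open>Weights and initial forms\<close>

lemma weight_add:
  assumes "Modules.module_hom (*s) (*) lam"
  shows "weight lam (a + b) = weight lam a + weight lam b"
proof -
  have "(\<chi> i. int (lookup (a + b) i)) = (\<chi> i. int (lookup a i)) + (\<chi> i. int (lookup b i))"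
    by (simp add: Finite_Cartesian_Product.vec_eq_iff lookup_add)
  then show ?thesis
    using module_hom.add[OF assms] by (simp add: weight_def)
qed

lemma lookup_initial_form:
  "lookup (initial_form lam f) a =
    (if a \<in> keys f \<and> weight lam a = Max (weight lam ` keys f) then lookup f a else 0)"
  by (simp add: initial_form_def lookup_sum lookup_single when_def)

lemma initial_form_nonzero:
  assumes "f \<noteq> 0"
  shows "initial_form lam f \<noteq> 0"
proof -
  have "keys f \<noteq> {}" using assms by simp
  then have "Max (weight lam ` keys f) \<in> weight lam ` keys f" by (intro Max_in) auto
  then obtain a where "a \<in> keys f" "weight lam a = Max (weight lam ` keys f)" by auto
  then have "lookup (initial_form lam f) a \<noteq> 0" by (simp add: lookup_initial_form in_keys_iff)
  then show ?thesis by (metis lookup_zero)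
qed

lemma keys_initial_form_subset: "keys (initial_form lam f) \<subseteq> keys f"
  by (auto simp: in_keys_iff lookup_initial_form split: if_splits)

lemma initial_ideal_eq_span:
  "initial_ideal lam I = idl.span {initial_form lam f | f. f \<in> I \<and> f \<noteq> 0}"
  by (simp add: initial_ideal_def genideal_ring_of_type_algebra)

lemma subspace_initial_ideal: "idl.subspace (initial_ideal lam I)"
  by (simp add: initial_ideal_eq_span)

context
  fixes lam :: "int ^ 'm \<Rightarrow> int" and I :: "('m::finite, 'k::field) mpoly set"
  assumes lam: "Modules.module_hom (*s) (*) lam" and I: "idl.subspace I"
begin

text \<open>Weights may be negative, hence integer powers; for \<open>t \<noteq> 0\<close> the map
  is a multiplicative character of the monomials.\<close>

definition weight_power :: "'k \<Rightarrow> ('m \<Rightarrow>\<^sub>0 nat) \<Rightarrow> 'k" where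
  "weight_power t a = t powi weight lam a"

lemma weight_power_add: "t \<noteq> 0 \<Longrightarrow> weight_power t (a + b) = weight_power t a * weight_power t b"
  by (simp add: weight_power_def weight_add[OF lam] power_int_add)

lemma weight_power_nonzero: "t \<noteq> 0 \<Longrightarrow> weight_power t a \<noteq> 0"
  by (simp add: weight_power_def)

abbreviation torus :: "'k \<Rightarrow> ('m, 'k) mpoly \<Rightarrow> ('m, 'k) mpoly" where
  "torus t \<equiv> twist (\<lambda>c. c) (weight_power t)"

text \<open>
  A family of polynomials over \<open>'k[t]\<close> evaluated at \<open>t\<close> and then moved by the torus, so that
  membership in \<open>\<phi>\<^sub>t\<^sup>-\<^sup>1(I)\<close> becomes membership in the fixed ideal \<open>I\<close>.
\<close>

abbreviation specialize :: "'k \<Rightarrow> (('m \<Rightarrow>\<^sub>0 nat) \<Rightarrow>\<^sub>0 'k poly) \<Rightarrow> ('m, 'k) mpoly" where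
  "specialize t \<equiv> twist (\<lambda>p. poly p t) (weight_power t)"

lemma
  assumes "t \<noteq> 0"
  shows lookup_torus: "lookup (torus t f) a = weight_power t a * lookup f a"
    and torus_zero: "torus t 0 = 0"
    and torus_add: "torus t (f + g) = torus t f + torus t g"
    and torus_single_mult: "torus t (single a c * f) = single a (weight_power t a * c) * torus t f"
    and keys_torus_subset: "keys (torus t f) \<subseteq> keys f"
  by (rule lookup_twist twist_zero twist_add twist_single_mult keys_twist_subset,
      rule comm_ring_hom_id, rule weight_power_add[OF assms])+

lemma
  assumes "t \<noteq> 0"
  shows lookup_specialize: "lookup (specialize t g) a = weight_power t a * poly (lookup g a) t"
    and specialize_zero: "specialize t 0 = 0"
    and specialize_add: "specialize t (g + g') = specialize t g + specialize t g'"
    and specialize_single_mult: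
      "specialize t (single a p * g) = single a (weight_power t a * poly p t) * specialize t g"
  by (rule lookup_twist twist_zero twist_add twist_single_mult,
      rule comm_ring_hom_poly, rule weight_power_add[OF assms])+

text \<open>Homogenizing \<open>f\<close> by its weight gives such a family for the initial form of
  \<open>f\<close>: the torus turns it back into a multiple of \<open>f\<close>. The elements that
  admit a family form an ideal, so the generators suffice.\<close>

lemma initial_ideal_deformation:
  assumes "h \<in> initial_ideal lam I"
  shows "\<exists>g. (\<forall>a. poly (lookup g a) 0 = lookup h a) \<and> (\<forall>t. t \<noteq> 0 \<longrightarrow> specialize t g \<in> I)"
proof -
  define D where "D = {h :: ('m, 'k) mpoly. \<exists>g. (\<forall>a. poly (lookup g a) 0 = lookup h a) \<and>
    (\<forall>t. t \<noteq> 0 \<longrightarrow> specialize t g \<in> I)}"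
  have "idl.subspace D"
  proof (rule ideal_subspaceI)
    show "0 \<in> D"
      using idl.subspace_0[OF I]
      unfolding D_def by (intro CollectI exI[of _ 0]) (simp add: specialize_zero)
  next
    fix f g assume "f \<in> D" "g \<in> D"
    then obtain f' g' where
      "\<And>a. poly (lookup f' a) 0 = lookup f a" "\<And>t. t \<noteq> 0 \<Longrightarrow> specialize t f' \<in> I"
      "\<And>a. poly (lookup g' a) 0 = lookup g a" "\<And>t. t \<noteq> 0 \<Longrightarrow> specialize t g' \<in> I"
      unfolding D_def by auto
    then show "f + g \<in> D"
      unfolding D_def using idl.subspace_add[OF I]
      by (intro CollectI exI[of _ "f' + g'"])
        (simp add: lookup_add specialize_add)
  next
    fix a c f assume "f \<in> D"
    then obtain g where
      g: "\<And>a. poly (lookup g a) 0 = lookup f a" "\<And>t. t \<noteq> 0 \<Longrightarrow> specialize t g \<in> I"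
      unfolding D_def by auto
    have "poly (lookup (single a [:c:] * g) b) 0 = lookup (single a c * f) b" for b
    proof (cases "\<exists>b'. b = a + b'")
      case True
      then obtain b' where "b = a + b'" by blast
      then show ?thesis using g(1)[of b'] by simp
    next
      case False
      then have b: "\<And>b'. b \<noteq> a + b'" by blast
      show ?thesis by (simp only: lookup_single_mult_eq_0[OF b] poly_0)
    qed
    then show "single a c * f \<in> D"
      unfolding D_def using idl.subspace_scale[OF I] g(2)
      by (intro CollectI exI[of _ "single a [:c:] * g"])
        (simp add: specialize_single_mult)
  qed
  moreover have "initial_form lam f \<in> D" if f: "f \<in> I" for f
  proof -
    define W where "W = Max (weight lam ` keys f)"
    have W: "weight lam a \<le> W" if "a \<in> keys f" for a
      unfolding W_def using that by (intro Max_ge) auto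
    \<comment> \<open>On the monomials of \<open>f\<close> the exponent of \<open>t\<close> is 0
      exactly at those of top weight, so at \<open>t = 0\<close> only the initial form
      survives.\<close>
    define g where "g = Poly_Mapping.mapp (\<lambda>a c. monom c (nat (W - weight lam a))) f"
    have g: "lookup g a = monom (lookup f a) (nat (W - weight lam a))" for a
      by (auto simp: g_def lookup_mapp when_def in_keys_iff)
    have "poly (lookup g a) 0 = lookup (initial_form lam f) a" for a
    proof (cases "a \<in> keys f \<and> weight lam a \<noteq> W")
      case True
      then have "nat (W - weight lam a) \<noteq> 0" using W[of a] by simp
      then show ?thesis
        using True by (simp add: g poly_monom lookup_initial_form W_def[symmetric])
    next
      case False
      then show ?thesis
        by (cases "a \<in> keys f")
          (simp_all add: g poly_monom lookup_initial_form W_def[symmetric] in_keys_iff)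
    qed
    moreover have "specialize t g \<in> I" if t: "t \<noteq> 0" for t
    proof -
      \<comment> \<open>The weight factors of the torus complete every exponent of \<open>t\<close>
        to the same \<open>W\<close>.\<close>
      have "specialize t g = single 0 (t powi W) * f"
      proof (rule poly_mapping_eqI)
        fix a
        show "lookup (specialize t g) a = lookup (single 0 (t powi W) * f) a"
        proof (cases "a \<in> keys f")
          case True
          then have W': "t powi weight lam a * t ^ nat (W - weight lam a) = t powi W"
            using W[of a] t by (simp add: power_int_of_nat[symmetric] power_int_add[symmetric]
                del: power_int_of_nat)
          have "lookup (specialize t g) a =
              t powi weight lam a * (lookup f a * t ^ nat (W - weight lam a))"
            by (simp add: lookup_specialize[OF t] g poly_monom weight_power_def)
          also have "\<dots> = lookup f a * t powi W"
            unfolding W'[symmetric] by (rule mult.left_commute)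
          finally show ?thesis unfolding lookup_const_mult by (simp only: mult.commute)
        next
          case False
          then show ?thesis by (simp add: lookup_specialize[OF t] g in_keys_iff)
        qed
      qed
      then show ?thesis using idl.subspace_scale[OF I f] by simp
    qed
    ultimately show ?thesis unfolding D_def by blast
  qed
  ultimately have "initial_ideal lam I \<subseteq> D"
    unfolding initial_ideal_eq_span by (intro idl.span_minimal) auto
  then show ?thesis using assms unfolding D_def by auto
qed

lemma torus_linear_forms: "V \<subseteq> forms n \<Longrightarrow> t \<noteq> 0 \<Longrightarrow> torus t ` V \<subseteq> forms n"
  using keys_torus_subset by (fastforce simp: homogeneous_of_degree_def)

text \<open>Compatibility of the torus with sums and, up to scalars, with multiplication by terms
  carries ideal generation over to the images.\<close>

lemma torus_span:
  assumes t: "t \<noteq> 0" and q: "q \<in> idl.span V"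
  shows "torus t q \<in> idl.span (torus t ` V)"
proof -
  have "idl.subspace {q. torus t q \<in> idl.span (torus t ` V)}"
    by (rule ideal_subspaceI)
      (simp_all add: t torus_zero torus_add torus_single_mult idl.span_zero idl.span_add
        idl.span_scale)
  then have "idl.span V \<subseteq> {q. torus t q \<in> idl.span (torus t ` V)}"
    by (intro idl.span_minimal) (auto intro: idl.span_base)
  then show ?thesis using q by auto
qed

text \<open>Each monomial of degree \<open>n\<close> is a sum of an element of the initial ideal and
  one of the ideal generated by \<open>V\<close>. Deforming the first summand yields elements whose
  coefficient matrix in degree \<open>n\<close> is the identity at \<open>t = 0\<close> and
  invertible at some other \<open>t\<close>.\<close>

lemma forms_subset_torus:
  assumes inf: "infinite (UNIV :: 'k set)" and gr: "graded I" and V: "V \<subseteq> forms 1"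
    and sub: "forms n \<subseteq> idl.span (initial_ideal lam I \<union> V)"
  shows "\<exists>t. t \<noteq> 0 \<and> forms n \<subseteq> idl.span (I \<union> torus t ` V)"
proof -
  have "\<exists>g q. q \<in> idl.span V \<and> (\<forall>t. t \<noteq> 0 \<longrightarrow> specialize t g \<in> I) \<and>
    (\<forall>b. poly (lookup g b) 0 + lookup q b = (if a = b then 1 else 0))" if a: "a \<in> monoms n" for a
  proof -
    have "single a (1 :: 'k) \<in> forms n" using a by (simp add: monoms_def)
    then have "single a 1 \<in> idl.span (initial_ideal lam I \<union> V)" using sub by blast
    then obtain h q where hq: "single a 1 = h + q" "h \<in> initial_ideal lam I" "q \<in> idl.span V"
      unfolding idl.span_Un idl.span_eq_iff[THEN iffD2, OF subspace_initial_ideal] by auto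
    obtain g where g: "\<And>a. poly (lookup g a) 0 = lookup h a" "\<And>t. t \<noteq> 0 \<Longrightarrow> specialize t g \<in> I"
      using initial_ideal_deformation[OF hq(2)] by blast
    have "lookup h b + lookup q b = (if a = b then 1 else 0)" for b
      using arg_cong[OF hq(1), of "\<lambda>f. lookup f b"] by (simp add: lookup_add lookup_single when_def)
    then show ?thesis using g hq(3) by (intro exI[of _ g] exI[of _ q]) auto
  qed
  then obtain g q where q: "\<And>a. a \<in> monoms n \<Longrightarrow> q a \<in> idl.span V"
    and g: "\<And>a t. a \<in> monoms n \<Longrightarrow> t \<noteq> 0 \<Longrightarrow> specialize t (g a) \<in> I"
    and gq: "\<And>a b. a \<in> monoms n \<Longrightarrow>
      poly (lookup (g a) b) 0 + lookup (q a) b = (if a = b then 1 else 0)"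
    by metis
  \<comment> \<open>Row \<open>a\<close> holds the deformed first summand plus the second one, whose
    coefficients are read as constant polynomials.\<close>
  define G where "G a b = lookup (g a) b + [:lookup (q a) b:]" for a b
  have "poly (G a b) 0 = (if a = b then 1 else 0)" if "a \<in> monoms n" "b \<in> monoms n" for a b
    using gq[OF that(1)] by (simp add: G_def)
  from perturbed_identity_solvable[OF inf finite_monoms this]
  obtain t where t: "t \<noteq> 0" and sol: "\<And>b. b \<in> monoms n \<Longrightarrow> \<exists>c. \<forall>b'\<in>monoms n.
      (\<Sum>a\<in>monoms n. c a * poly (G a b') t) = (if b = b' then 1 else 0)" by blast
  define K where "K = idl.span (I \<union> torus t ` V)"
  have K: "idl.subspace K" by (simp add: K_def)
  have grK: "graded K" unfolding K_def
    by (rule graded_span_Un_forms[OF gr torus_linear_forms[OF V t]])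
  have inK: "specialize t (g a) + torus t (q a) \<in> K" if "a \<in> monoms n" for a
  proof (rule idl.subspace_add[OF K])
    show "specialize t (g a) \<in> K"
      using g[OF that t] idl.span_base[of _ "I \<union> torus t ` V"] by (simp add: K_def)
    show "torus t (q a) \<in> K"
      using torus_span[OF t q[OF that]] idl.span_mono[of "torus t ` V" "I \<union> torus t ` V"]
      by (auto simp: K_def)
  qed
  have "forms n \<subseteq> K"
  proof (rule forms_subsetI[OF vs_subspace_of_ideal[OF K]])
    fix b :: "'m \<Rightarrow>\<^sub>0 nat" assume "monom_degree b = n"
    then have b: "b \<in> monoms n" by (simp add: monoms_def)
    obtain c where c: "\<And>b'. b' \<in> monoms n \<Longrightarrow>
      (\<Sum>a\<in>monoms n. c a * poly (G a b') t) = (if b = b' then 1 else 0)"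
      using sol[OF b] by blast
    \<comment> \<open>The solution \<open>c\<close> isolates \<open>b\<close> in degree
      \<open>n\<close>. Terms of \<open>F\<close> in other degrees are not controlled;
      \<open>hcomp\<close> removes them, which is legitimate because \<open>K\<close> is
      graded.\<close>
    define F where "F = (\<Sum>a\<in>monoms n. single 0 (c a) * (specialize t (g a) + torus t (q a)))"
    have "F \<in> K" unfolding F_def
      by (intro idl.subspace_sum[OF K] idl.subspace_scale[OF K] inK)
    then have "hcomp n F \<in> K" using grK by (simp add: graded_def)
    moreover have "hcomp n F = single b (weight_power t b)"
    proof (rule poly_mapping_eqI)
      fix b'
      have "lookup F b' = (\<Sum>a\<in>monoms n. c a * (weight_power t b' * poly (G a b') t))"
        by (simp add: F_def lookup_sum lookup_add lookup_specialize[OF t] lookup_torus[OF t] G_def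
            distrib_left)
      also have "\<dots> = weight_power t b' * (\<Sum>a\<in>monoms n. c a * poly (G a b') t)"
        unfolding sum_distrib_left by (intro sum.cong refl mult.left_commute)
      finally have F: "lookup F b' = weight_power t b' * (\<Sum>a\<in>monoms n. c a * poly (G a b') t)" .
      show "lookup (hcomp n F) b' = lookup (single b (weight_power t b)) b'"
      proof (cases "b' \<in> monoms n")
        case True
        then have "lookup F b' = (if b = b' then weight_power t b else 0)" using F c[OF True] by simp
        then show ?thesis using True by (simp add: lookup_hcomp lookup_single monoms_def when_def)
      next
        case False
        then have "b \<noteq> b'" using b by blast
        then show ?thesis
          using False by (simp add: lookup_hcomp lookup_single_not_eq monoms_def)
      qed
    qed
    ultimately have "single b (weight_power t b) \<in> K" by simp
    then have "single 0 (inverse (weight_power t b)) * single b (weight_power t b) \<in> K"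
      by (rule idl.subspace_scale[OF K])
    then show "single b 1 \<in> K" using weight_power_nonzero[OF t] by (simp add: mult_single)
  qed
  then show ?thesis using t unfolding K_def by blast
qed

end

section \<open>Hilbert functions and power products\<close>

lemma vs_span_subset_idl_span: "vs.span S \<subseteq> idl.span S"
  by (intro vs.span_minimal idl.span_superset vs_subspace_of_ideal idl.subspace_span)

lemma independent_linear_forms_finite:
  fixes B :: "('m::finite, 'k::field) mpoly set"
  assumes "vs.independent B" "B \<subseteq> forms n"
  shows "finite B"
proof -
  define M where "M = (\<lambda>a. single a (1 :: 'k)) ` (monoms n :: ('m \<Rightarrow>\<^sub>0 nat) set)"
  have "forms n \<subseteq> vs.span M"
    by (rule forms_subsetI[OF vs.subspace_span]) (auto simp: M_def monoms_def intro: vs.span_base)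
  then have "B \<subseteq> vs.span M" using assms(2) by (rule order_trans[rotated])
  then show ?thesis
    using vs.independent_span_bound[of M B] assms(1) by (simp add: M_def)
qed

text \<open>Comparison of Hilbert functions: monomials independent modulo the initial ideal are
  independent modulo \<open>I\<close>, since the initial form of a relation in \<open>I\<close>
  would be a relation in the initial ideal supported on the same monomials. A maximal such set also
  spans.\<close>

lemma standard_monomials:
  fixes I :: "('m::finite, 'k::field) mpoly set"
  assumes I: "idl.subspace I" and T: "finite T" "forms n \<subseteq> vs.span (I \<union> T)"
  shows "\<exists>S\<subseteq>monoms n. card S \<le> card T \<and>
    forms n \<subseteq> vs.span (initial_ideal lam I \<union> (\<lambda>a. single a 1) ` S)"
proof -
  define J where "J = initial_ideal lam I"
  have J: "idl.subspace J" unfolding J_def by (rule subspace_initial_ideal)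
  \<comment> \<open>Linear independence of the monomials modulo \<open>J\<close>. As
    \<open>J\<close> need not be a monomial ideal, it would not be enough that none of them lies in
    \<open>J\<close>.\<close>
  define std where "std S \<longleftrightarrow> S \<subseteq> monoms n \<and> (\<forall>f\<in>J. keys f \<subseteq> S \<longrightarrow> f = 0)" for S
  have "std {}" by (simp add: std_def)
  moreover have bound: "\<forall>S. std S \<longrightarrow> card S < Suc (card (monoms n :: ('m \<Rightarrow>\<^sub>0 nat) set))"
    unfolding std_def by (simp add: le_imp_less_Suc card_mono)
  ultimately have "\<exists>S. std S \<and> (\<forall>S'. std S' \<longrightarrow> card S' \<le> card S)"
    by (rule ex_has_greatest_nat[of std "{}" card])
  then obtain S where S: "std S" and max: "\<And>S'. std S' \<Longrightarrow> card S' \<le> card S"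
    by (elim exE conjE) simp
  have Sn: "S \<subseteq> monoms n" and finS: "finite S"
    using S finite_subset[OF _ finite_monoms] by (auto simp: std_def)
  have "card S \<le> card T"
  proof (rule ccontr)
    assume "\<not> card S \<le> card T"
    then have less: "card T < card S" by simp
    have "single a 1 \<in> vs.span (I \<union> T)" if "a \<in> S" for a
    proof -
      have "single a (1 :: 'k) \<in> forms n" using that Sn by (auto simp: monoms_def)
      then show ?thesis using T(2) by (rule rev_subsetD)
    qed
    from vs.dependent_modulo_subspace[where b = "\<lambda>a. single a 1",
      OF T(1) finS less vs_subspace_of_ideal[OF I] this]
    obtain c where c: "\<exists>a\<in>S. c a \<noteq> 0" "(\<Sum>a\<in>S. single 0 (c a) * single a (1 :: 'k)) \<in> I"
      by blast
    define f where "f = (\<Sum>a\<in>S. single 0 (c a) * single a (1 :: 'k))"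
    have f: "lookup f a = (if a \<in> S then c a else 0)" for a
      using finS by (simp add: f_def lookup_sum mult_single lookup_single when_def)
    have "f \<noteq> 0"
    proof
      assume "f = 0"
      then have "lookup f a = 0" for a by simp
      then show False using c(1) f by metis
    qed
    moreover have "f \<in> I" using c(2) by (simp add: f_def)
    ultimately have "initial_form lam f \<in> J"
      unfolding J_def initial_ideal_eq_span by (intro idl.span_base) blast
    moreover have "keys (initial_form lam f) \<subseteq> S"
      using keys_initial_form_subset[of lam f] by (auto simp: in_keys_iff f split: if_splits)
    ultimately show False using S initial_form_nonzero[OF \<open>f \<noteq> 0\<close>] by (auto simp: std_def)
  qed
  moreover have "forms n \<subseteq> vs.span (J \<union> (\<lambda>a. single a 1) ` S)" (is "_ \<subseteq> ?K")
  proof (rule forms_subsetI[OF vs.subspace_span])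
    fix b :: "'m \<Rightarrow>\<^sub>0 nat" assume b: "monom_degree b = n"
    show "single b 1 \<in> ?K"
    proof (cases "b \<in> S")
      case True
      then show ?thesis by (intro vs.span_base) blast
    next
      case False
      then have "card (insert b S) > card S" using finS by simp
      \<comment> \<open>Maximality of \<open>S\<close> gives an element of \<open>J\<close> that
        involves \<open>b\<close> and otherwise only monomials of \<open>S\<close>; it can be solved
        for \<open>b\<close>.\<close>
      then have "\<not> std (insert b S)" using max[of "insert b S"] by linarith
      then obtain f where f: "f \<in> J" "keys f \<subseteq> insert b S" "f \<noteq> 0"
        using Sn b by (auto simp: std_def monoms_def)
      have fb: "lookup f b \<noteq> 0"
      proof
        assume "lookup f b = 0"
        then have "keys f \<subseteq> S" using f(2) by (auto simp: in_keys_iff)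
        then show False using S f by (auto simp: std_def)
      qed
      have "f = (\<Sum>a\<in>keys f. single a (lookup f a))" by (rule poly_mapping_sum_singles)
      also have "\<dots> = (\<Sum>a\<in>insert b S. single a (lookup f a))"
        by (rule sum.mono_neutral_left) (use f finS in \<open>auto simp: in_keys_iff\<close>)
      also have "\<dots> = single b (lookup f b) + (\<Sum>a\<in>S. single a (lookup f a))"
        using False finS by simp
      finally have eq: "single b (lookup f b) = f - (\<Sum>a\<in>S. single a (lookup f a))"
        by (simp only: eq_diff_eq)
      have "single a (lookup f a) \<in> ?K" if "a \<in> S" for a
      proof -
        have "single 0 (lookup f a) * single a 1 \<in> ?K"
          using that by (intro vs.span_scale vs.span_base) blast
        then show ?thesis by (simp add: mult_single)
      qed
      then have "single b (lookup f b) \<in> ?K"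
        unfolding eq by (intro vs.span_diff vs.span_sum vs.span_base[of f] UnI1 f(1))
      then have "single 0 (inverse (lookup f b)) * single b (lookup f b) \<in> ?K"
        by (rule vs.span_scale)
      then show ?thesis using fb by (simp add: mult_single)
    qed
  qed
  ultimately show ?thesis using Sn unfolding J_def by blast
qed

section \<open>Power products of lists\<close>

lemma power_list_update:
  "j < length xs \<Longrightarrow> length \<beta> = length xs \<Longrightarrow>
    power_list xs (\<beta>[j := Suc (\<beta> ! j)]) = xs ! j * power_list xs \<beta>"
proof (induction xs arbitrary: \<beta> j)
  case (Cons x xs)
  then obtain b \<beta>' where "\<beta> = b # \<beta>'" by (metis length_Suc_conv)
  then show ?case using Cons by (cases j) (simp_all add: mult.assoc mult.left_commute)
qed simp

lemma power_list_replicate_0: "power_list xs (replicate (length xs) 0) = 1"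
  by (induction xs) simp_all

text \<open>Homogeneity of degree \<open>sum_list \<beta>\<close>; it serves both to rescale points
  and to collect the powers of a linear form \<open>l\<close>.\<close>

lemma power_list_mult_right:
  fixes l :: "'a::comm_monoid_mult"
  shows "length \<beta> = length xs \<Longrightarrow>
    power_list (map (\<lambda>x. x * l) xs) \<beta> = power_list xs \<beta> * l ^ sum_list \<beta>"
proof (induction xs arbitrary: \<beta>)
  case (Cons x xs)
  then obtain b \<beta>' where "\<beta> = b # \<beta>'" by (metis length_Suc_conv)
  then show ?case using Cons by (simp add: power_mult_distrib power_add mult_ac)
qed simp

lemma single_0_power: "single (0 :: 'a::comm_monoid_add) (c :: 'k::comm_ring_1) ^ n = single 0 (c ^ n)"
  by (induction n) (simp_all add: mult_single)

lemma power_list_map_single_0: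
  "power_list (map (single (0 :: 'a::comm_monoid_add)) (u :: 'k::comm_ring_1 list)) \<beta> =
    single 0 (power_list u \<beta>)"
proof (induction u arbitrary: \<beta>)
  case (Cons x u)
  then show ?case by (cases \<beta>) (simp_all add: single_0_power mult_single)
qed simp

lemma forms_one [simp]: "homogeneous_of_degree 0 1"
  by (simp add: homogeneous_of_degree_def)

lemma forms_power: "homogeneous_of_degree 1 f \<Longrightarrow> homogeneous_of_degree n (f ^ n)"
proof (induction n)
  case 0
  show ?case by simp
next
  case (Suc n)
  then show ?case using forms_mult[of 1 f n "f ^ n"] by simp
qed

lemma forms_power_list:
  "set xs \<subseteq> forms 1 \<Longrightarrow> length \<beta> = length xs \<Longrightarrow>
    homogeneous_of_degree (sum_list \<beta>) (power_list xs \<beta>)"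
proof (induction xs arbitrary: \<beta>)
  case Nil
  then show ?case by simp
next
  case (Cons x xs)
  then obtain b \<beta>' where "\<beta> = b # \<beta>'" by (metis length_Suc_conv)
  then show ?case using Cons by (simp add: forms_mult forms_power)
qed

section \<open>Congruences of power products modulo an ideal\<close>

lemma ideal_diff_mult:
  fixes K :: "'a::comm_ring_1 set"
  assumes "idl.subspace K" "x - x' \<in> K" "y - y' \<in> K"
  shows "x * y - x' * y' \<in> K"
proof -
  have "x * y - x' * y' = x * (y - y') + y' * (x - x')" by (simp add: algebra_simps)
  then show ?thesis
    using assms by (simp only: idl.subspace_add idl.subspace_scale)
qed

lemma ideal_diff_power:
  fixes K :: "'a::comm_ring_1 set"
  assumes "idl.subspace K" "x - x' \<in> K"
  shows "x ^ n - x' ^ n \<in> K"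
proof (induction n)
  case 0
  then show ?case using idl.subspace_0[OF assms(1)] by simp
next
  case (Suc n)
  then show ?case using ideal_diff_mult[OF assms Suc] by simp
qed

lemma ideal_diff_power_list:
  fixes K :: "'a::comm_ring_1 set"
  assumes "idl.subspace K" "list_all2 (\<lambda>x y. x - y \<in> K) xs ys"
  shows "power_list xs \<beta> - power_list ys \<beta> \<in> K"
  using assms(2)
proof (induction arbitrary: \<beta> rule: list_all2_induct)
  case Nil
  then show ?case using idl.subspace_0[OF assms(1)] by simp
next
  case (Cons x xs y ys)
  note step = Cons
  show ?case
  proof (cases \<beta>)
    case Nil
    then show ?thesis using idl.subspace_0[OF assms(1)] by simp
  next
    case (Cons b \<beta>')
    then show ?thesis
      using ideal_diff_mult[OF assms(1) ideal_diff_power[OF assms(1) step(1)] step(3)]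
      by simp
  qed
qed

section \<open>Generators of minimal reductions\<close>

lemma smaller_reduction_of_dependent:
  fixes J :: "('m::finite, 'k::field) mpoly set"
  assumes inf: "infinite (UNIV :: 'k set)" and J: "idl.subspace J"
    and ls: "set ls \<subseteq> forms 1" "reduces (idl.span (J \<union> set ls))"
    and n: "n > 0" and c: "\<exists>\<beta>\<in>exponents (length ls) n. c \<beta> \<noteq> 0"
    and dep: "(\<Sum>\<beta>\<in>exponents (length ls) n. single 0 (c \<beta>) * power_list ls \<beta>) \<in> J"
  shows "\<exists>M. finite M \<and> card M < length ls \<and> M \<subseteq> forms 1 \<and> M \<subseteq> idl.span (set ls) \<and>
    reduces (idl.span (J \<union> M))"
proof -
  define d where "d = length ls"
  define E where "E = exponents d n"
  have lenE: "length \<beta> = d" and sumE: "sum_list \<beta> = n" if "\<beta> \<in> E" for \<beta>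
    using that by (simp_all add: E_def exponents_def)
  have "\<exists>u. length u = d \<and> (\<Sum>\<beta>\<in>E. c \<beta> * power_list u \<beta>) \<noteq> 0"
  proof (rule exists_power_list_nonroot[OF inf])
    show "finite E" by (simp add: E_def)
    show "\<exists>\<beta>\<in>E. c \<beta> \<noteq> 0" using c by (simp add: E_def d_def)
  qed (rule lenE)
  then obtain u where u: "length u = d" "(\<Sum>\<beta>\<in>E. c \<beta> * power_list u \<beta>) \<noteq> 0" by blast
  have "\<exists>p<d. u ! p \<noteq> 0"
  proof (rule ccontr)
    assume "\<not> (\<exists>p<d. u ! p \<noteq> 0)"
    \<comment> \<open>A zero point is its own multiple by 0, so homogeneity in positive degree
      forces the value 0.\<close>
    then have u0: "u = map (\<lambda>x. x * 0) u"
      using u(1) by (intro nth_equalityI) auto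
    have "power_list u \<beta> = 0" if "\<beta> \<in> E" for \<beta>
    proof -
      have "power_list (map (\<lambda>x. x * 0) u) \<beta> = power_list u \<beta> * 0 ^ n"
        using power_list_mult_right[of \<beta> u 0] lenE[OF that] sumE[OF that] u(1) by simp
      then have "power_list u \<beta> = power_list u \<beta> * 0 ^ n" by (simp only: u0[symmetric])
      also have "\<dots> = 0" using n by simp
      finally show ?thesis .
    qed
    then show False using u(2) by simp
  qed
  then obtain p where p: "p < d" "u ! p \<noteq> 0" by blast
  define l where "l = ls ! p"
  \<comment> \<open>By homogeneity this rescaling multiplies the value by a nonzero
    constant.\<close>
  define v where "v = map (\<lambda>x. x * inverse (u ! p)) u"
  have v: "length v = d" "v ! p = 1" using u(1) p by (simp_all add: v_def)
  have "(\<Sum>\<beta>\<in>E. c \<beta> * power_list v \<beta>)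
      = (\<Sum>\<beta>\<in>E. c \<beta> * power_list u \<beta> * inverse (u ! p) ^ n)"
  proof (rule sum.cong[OF refl])
    fix \<beta> assume \<beta>: "\<beta> \<in> E"
    have "power_list v \<beta> = power_list u \<beta> * inverse (u ! p) ^ n"
      unfolding v_def sumE[OF \<beta>, symmetric]
      by (rule power_list_mult_right) (simp only: lenE[OF \<beta>] u(1))
    then show "c \<beta> * power_list v \<beta> = c \<beta> * power_list u \<beta> * inverse (u ! p) ^ n"
      by (simp only: mult.assoc)
  qed
  also have "\<dots> = (\<Sum>\<beta>\<in>E. c \<beta> * power_list u \<beta>) * inverse (u ! p) ^ n"
    by (rule sum_distrib_right[symmetric])
  finally have Fv: "(\<Sum>\<beta>\<in>E. c \<beta> * power_list v \<beta>) \<noteq> 0" using u(2) p(2) by simp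
  define m where "m i = ls ! i - single 0 (v ! i) * l" for i
  define M where "M = m ` ({..<d} - {p})"
  define K where "K = idl.span (J \<union> M)"
  have K: "idl.subspace K" by (simp add: K_def)
  have JK: "J \<subseteq> K" and MK: "M \<subseteq> K"
    using idl.span_superset[of "J \<union> M"] by (auto simp: K_def)
  have ls_i: "ls ! i \<in> set ls" if "i < d" for i using that by (simp add: d_def)
  have M1: "m i \<in> forms 1" if "i < d" for i
  proof -
    have "ls ! i \<in> forms 1" "l \<in> forms 1" using ls(1) ls_i that p(1) by (auto simp: l_def)
    then show ?thesis unfolding m_def
      by (intro vs.subspace_diff[OF subspace_forms] vs.subspace_scale[OF subspace_forms])
  qed
  have Mls: "m i \<in> idl.span (set ls)" if "i < d" for i
    unfolding m_def l_def using ls_i that p(1)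
    by (intro idl.span_diff idl.span_scale idl.span_base) auto
  have mK: "m i \<in> K" if "i < d" for i
  proof (cases "i = p")
    case True
    then show ?thesis using v(2) idl.subspace_0[OF K] by (simp add: m_def l_def)
  next
    case False
    then show ?thesis using MK that by (auto simp: M_def)
  qed
  have "card M \<le> card ({..<d} - {p})" unfolding M_def by (rule card_image_le) simp
  also have "\<dots> < d" using p(1) by simp
  finally have card: "card M < length ls" by (simp add: d_def)

  \<comment> \<open>Modulo \<open>K\<close> each form in \<open>ls\<close> agrees with the scalar
    multiple of \<open>l\<close> at the same place of \<open>w\<close>.\<close>
  define w where "w = map (\<lambda>x. x * l) (map (single 0) v)"
  have "list_all2 (\<lambda>x y. x - y \<in> K) ls w"
    using mK v(1) by (auto simp: list_all2_conv_all_nth w_def d_def m_def)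
  from ideal_diff_power_list[OF K this]
  have cong: "power_list ls \<beta> - power_list w \<beta> \<in> K" for \<beta> .
  have w: "power_list w \<beta> = single 0 (power_list v \<beta>) * l ^ n" if "\<beta> \<in> E" for \<beta>
    unfolding w_def sumE[OF that, symmetric] power_list_map_single_0[symmetric]
    by (rule power_list_mult_right) (simp only: length_map lenE[OF that] v(1))
  define a where "a = (\<Sum>\<beta>\<in>E. c \<beta> * power_list v \<beta>)"
  have "(\<Sum>\<beta>\<in>E. single 0 (c \<beta>) * power_list ls \<beta>) -
      (\<Sum>\<beta>\<in>E. single 0 (c \<beta>) * (power_list ls \<beta> - power_list w \<beta>)) =
      (\<Sum>\<beta>\<in>E. single 0 (c \<beta>) * power_list w \<beta>)"
    by (simp add: right_diff_distrib sum_subtractf)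
  also have "\<dots> = (\<Sum>\<beta>\<in>E. single 0 (c \<beta> * power_list v \<beta>)) * l ^ n"
    unfolding sum_distrib_right
    by (rule sum.cong[OF refl]) (simp add: w mult_single mult.assoc[symmetric])
  also have "(\<Sum>\<beta>\<in>E. single 0 (c \<beta> * power_list v \<beta>)) = single 0 a"
    unfolding a_def
    by (rule poly_mapping_eqI) (simp add: lookup_sum lookup_single when_def)
  finally have "single 0 a * l ^ n \<in> K"
    using dep JK idl.subspace_diff[OF K] idl.subspace_sum[OF K, of E] idl.subspace_scale[OF K cong]
    by (metis (no_types, lifting) E_def d_def subsetD)
  then have "single 0 (inverse a) * (single 0 a * l ^ n) \<in> K" by (rule idl.subspace_scale[OF K])
  then have ln: "l ^ n \<in> K"
    using Fv by (simp add: mult.assoc[symmetric] mult_single a_def)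

  obtain N where N: "forms N \<subseteq> idl.span (J \<union> set ls)"
    using ls(2) unfolding reduces_def by blast
  have "J \<union> set ls \<subseteq> idl.span (insert l K)"
  proof
    fix x assume "x \<in> J \<union> set ls"
    then show "x \<in> idl.span (insert l K)"
    proof
      assume "x \<in> J"
      then show ?thesis using JK by (intro idl.span_base) auto
    next
      assume "x \<in> set ls"
      then obtain i where i: "i < d" "x = ls ! i" by (auto simp: in_set_conv_nth d_def)
      have "x - single 0 (v ! i) * l \<in> idl.span K"
        using mK[OF i(1)] unfolding i(2) m_def by (rule idl.span_base)
      then show ?thesis unfolding idl.span_breakdown_eq by blast
    qed
  qed
  then have "idl.span (J \<union> set ls) \<subseteq> idl.span (insert l K)"
    by (rule idl.span_minimal) (rule idl.subspace_span)
  then have "forms N \<subseteq> idl.span (insert l K)" using N by (rule order_trans[rotated])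
  then have NK: "\<exists>k. x - k * l \<in> K" if "x \<in> forms N" for x
    using that idl.span_eq_iff[THEN iffD2, OF K] unfolding idl.span_breakdown_eq subset_iff by simp
  \<comment> \<open>Each factor of degree \<open>N\<close> contributes one factor \<open>l\<close>
    modulo \<open>K\<close>, so degree \<open>N * n\<close> reaches \<open>l ^ n\<close>, which lies
    in \<open>K\<close>.\<close>
  have "\<exists>k. single b 1 - k * l ^ j \<in> K" if "monom_degree b = N * j" for b j
    using that
  proof (induction j arbitrary: b)
    case 0
    then show ?case using idl.subspace_0[OF K] by (intro exI[of _ "single b 1"]) simp
  next
    case (Suc j)
    then obtain b1 b2 where b: "b = b1 + b2" "monom_degree b1 = N" "monom_degree b2 = N * j"
      using monom_degree_split[of b N "N * j"] by auto
    have "single b1 (1 :: 'k) \<in> forms N" using b by simp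
    then obtain k1 where k1: "single b1 1 - k1 * l \<in> K" using NK by blast
    obtain k2 where k2: "single b2 1 - k2 * l ^ j \<in> K" using Suc.IH[OF b(3)] by blast
    have "single b1 1 * single b2 1 - (k1 * l) * (k2 * l ^ j) \<in> K"
      by (rule ideal_diff_mult[OF K k1 k2])
    moreover have "single b (1 :: 'k) = single b1 1 * single b2 1" by (simp add: b(1) mult_single)
    moreover have "(k1 * l) * (k2 * l ^ j) = (k1 * k2) * l ^ Suc j" by (simp only: power_Suc mult_ac)
    ultimately show ?case by (intro exI[of _ "k1 * k2"]) (simp only:)
  qed
  then have "forms (N * n) \<subseteq> K"
  proof (intro forms_subsetI[OF vs_subspace_of_ideal[OF K]])
    fix b :: "'m \<Rightarrow>\<^sub>0 nat"
    assume "\<And>b j. monom_degree b = N * j \<Longrightarrow> \<exists>k. single b 1 - k * l ^ j \<in> K"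
      and "monom_degree b = N * n"
    then obtain k where "single b 1 - k * l ^ n \<in> K" by blast
    then have "(single b 1 - k * l ^ n) + k * l ^ n \<in> K"
      using idl.subspace_add[OF K] idl.subspace_scale[OF K ln] by blast
    then show "single b 1 \<in> K" by simp
  qed
  then have "reduces K" by (rule reducesI[OF K])
  moreover have "M \<subseteq> forms 1" using M1 by (auto simp: M_def)
  moreover have "M \<subseteq> idl.span (set ls)" using Mls by (auto simp: M_def)
  ultimately show ?thesis using card unfolding K_def by (intro exI[of _ M]) (simp add: M_def)
qed

text \<open>Take a generating set of least size; a linear basis chosen inside \<open>V\<close> shows
  that a finite one exists. By minimality of \<open>V\<close>, a reducing \<open>M\<close> in the
  ideal of \<open>L\<close> generates the same ideal together with \<open>J\<close>, so it competes
  in this choice.\<close>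

lemma minimal_generators_of_minimal_reduction:
  fixes J :: "('m::finite, 'k::field) mpoly set"
  assumes "minimally_reduces J V"
  shows "\<exists>L. finite L \<and> L \<subseteq> forms 1 \<and> idl.span (J \<union> L) = idl.span (J \<union> V) \<and>
    (\<forall>M. finite M \<longrightarrow> M \<subseteq> forms 1 \<longrightarrow> M \<subseteq> idl.span L \<longrightarrow> reduces (idl.span (J \<union> M)) \<longrightarrow>
      card L \<le> card M)"
proof -
  have V: "V \<subseteq> forms 1"
    and min: "\<And>V'. V' \<subseteq> forms 1 \<Longrightarrow> reduces (idl.span (J \<union> V')) \<Longrightarrow>
      idl.span (J \<union> V') \<subseteq> idl.span (J \<union> V) \<Longrightarrow> idl.span (J \<union> V') = idl.span (J \<union> V)"
    using assms by (simp_all add: minimally_reduces_def)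
  define Q where "Q L \<longleftrightarrow> finite L \<and> L \<subseteq> forms 1 \<and> idl.span (J \<union> L) = idl.span (J \<union> V)" for L
  obtain B where B: "B \<subseteq> V" "vs.independent B" "V \<subseteq> vs.span B"
    by (rule vs.maximal_independent_subset)
  have "V \<subseteq> idl.span (J \<union> B)"
    using B(3) vs_span_subset_idl_span[of B] idl.span_mono[of B "J \<union> B"] by blast
  then have "J \<union> V \<subseteq> idl.span (J \<union> B)" using idl.span_superset[of "J \<union> B"] by blast
  then have "idl.span (J \<union> V) \<subseteq> idl.span (J \<union> B)"
    by (rule idl.span_minimal) (rule idl.subspace_span)
  moreover have "idl.span (J \<union> B) \<subseteq> idl.span (J \<union> V)"
    using B(1) by (intro idl.span_mono) blast
  ultimately have "Q B"
    using independent_linear_forms_finite[OF B(2) order_trans[OF B(1) V]] B(1) V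
    unfolding Q_def by blast
  then have "\<exists>L. Q L \<and> (\<forall>L'. Q L' \<longrightarrow> card L \<le> card L')"
    by (rule ex_has_least_nat)
  then obtain L where L: "Q L" "\<And>L'. Q L' \<Longrightarrow> card L \<le> card L'" by blast
  have "card L \<le> card M" if M: "finite M" "M \<subseteq> forms 1" "M \<subseteq> idl.span L"
    "reduces (idl.span (J \<union> M))" for M
  proof (rule L(2))
    have "J \<union> M \<subseteq> idl.span (J \<union> L)"
      using M(3) idl.span_mono[of L "J \<union> L"] idl.span_superset[of "J \<union> L"] by blast
    then have "idl.span (J \<union> M) \<subseteq> idl.span (J \<union> L)"
      by (rule idl.span_minimal) (rule idl.subspace_span)
    then have "idl.span (J \<union> M) = idl.span (J \<union> V)"
      using L(1) M by (intro min) (simp_all add: Q_def)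
    then show "Q M" using M by (simp add: Q_def)
  qed
  then show ?thesis using L(1) unfolding Q_def by (intro exI[of _ L]) blast
qed

text \<open>Choose a reduction whose degree one part has least dimension. A reduction inside it has
  a degree one part of the same dimension, hence the same one, and this contains the generators
  \<open>V\<close>.\<close>

lemma exists_minimal_reduction:
  fixes J :: "('m::finite, 'k::field) mpoly set"
  shows "\<exists>V. minimally_reduces J V"
proof -
  define W where "W V = idl.span (J \<union> V) \<inter> forms 1" for V
  \<comment> \<open>The second component is a basis of the degree one part, so its cardinality is
    the dimension to be minimized.\<close>
  define Q where "Q p \<longleftrightarrow> fst p \<subseteq> forms 1 \<and> reduces (idl.span (J \<union> fst p)) \<and>
    snd p \<subseteq> W (fst p) \<and> vs.independent (snd p) \<and> W (fst p) \<subseteq> vs.span (snd p)" for p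
  have "\<exists>p. Q p"
  proof -
    obtain B where "B \<subseteq> W (forms 1)" "vs.independent B" "W (forms 1) \<subseteq> vs.span B"
      by (rule vs.maximal_independent_subset)
    moreover have "forms 1 \<subseteq> idl.span (J \<union> forms 1)"
      by (rule order_trans[OF Un_upper2 idl.span_superset])
    then have "reduces (idl.span (J \<union> forms 1))" by (rule reducesI[OF idl.subspace_span])
    ultimately have "Q (forms 1, B)" by (simp add: Q_def)
    then show ?thesis by (rule exI)
  qed
  then obtain p0 where "Q p0" ..
  then have "\<exists>p. Q p \<and> (\<forall>p'. Q p' \<longrightarrow> card (snd p) \<le> card (snd p'))"
    by (rule ex_has_least_nat)
  then obtain V B where VB: "Q (V, B)" and min: "\<And>V' B'. Q (V', B') \<Longrightarrow> card B \<le> card B'"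
    by fastforce
  have V: "V \<subseteq> forms 1" "reduces (idl.span (J \<union> V))"
    and B: "B \<subseteq> W V" "vs.independent B" "W V \<subseteq> vs.span B"
    using VB by (simp_all add: Q_def)
  have finB: "finite B"
    using B(1,2) by (intro independent_linear_forms_finite[of B 1]) (auto simp: W_def)
  have "idl.span (J \<union> V') = idl.span (J \<union> V)"
    if V': "V' \<subseteq> forms 1" "reduces (idl.span (J \<union> V'))" "idl.span (J \<union> V') \<subseteq> idl.span (J \<union> V)" for V'
  proof -
    obtain B' where B': "B' \<subseteq> W V'" "vs.independent B'" "W V' \<subseteq> vs.span B'"
      by (rule vs.maximal_independent_subset)
    then have card: "card B \<le> card B'" using V' by (intro min[of V']) (simp add: Q_def)
    have "B' \<subseteq> vs.span B" using B'(1) B(3) V'(3) unfolding W_def by blast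
    then have "B \<subseteq> vs.span B'" by (rule vs.subset_span_of_card_le[OF B'(2) _ finB card])
    also have "vs.span B' \<subseteq> idl.span (J \<union> V')"
      using B'(1) by (intro vs.span_minimal vs_subspace_of_ideal idl.subspace_span) (auto simp: W_def)
    finally have "vs.span B \<subseteq> idl.span (J \<union> V')"
      by (intro vs.span_minimal vs_subspace_of_ideal idl.subspace_span)
    moreover have "V \<subseteq> W V" using V(1) idl.span_superset[of "J \<union> V"] unfolding W_def by blast
    ultimately have "J \<union> V \<subseteq> idl.span (J \<union> V')"
      using B(3) idl.span_superset[of "J \<union> V'"] by blast
    then have "idl.span (J \<union> V) \<subseteq> idl.span (J \<union> V')"
      by (rule idl.span_minimal) (rule idl.subspace_span)
    then show ?thesis using V'(3) by (rule equalityI[rotated])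
  qed
  then show ?thesis using V unfolding minimally_reduces_def by (intro exI[of _ V]) simp
qed

text \<open>Modulo \<open>I\<close> every form of degree \<open>s + k + 1\<close> is a sum of
  multiples of the \<open>ms\<close> by forms of degree \<open>s + k\<close>; descending to degree
  \<open>s\<close> leaves power products times monomials. This bounds the Hilbert function of R/I by
  a constant times the number of exponent vectors.\<close>

lemma forms_subset_span_power_products:
  fixes I :: "('m::finite, 'k::field) mpoly set"
  assumes I: "idl.subspace I" "graded I" and ms: "set ms \<subseteq> forms 1"
    and sub: "\<And>n. n \<ge> s \<Longrightarrow> forms n \<subseteq> idl.span (I \<union> set ms)"
  shows "forms (s + k) \<subseteq> vs.span (I \<union>
    (\<lambda>(\<beta>, a). power_list ms \<beta> * single a 1) ` (exponents (length ms) k \<times> monoms s))"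
    (is "_ \<subseteq> vs.span (I \<union> ?T k)")
proof (induction k)
  case 0
  show ?case
  proof (rule forms_subsetI[OF vs.subspace_span])
    fix a :: "'m \<Rightarrow>\<^sub>0 nat" assume "monom_degree a = s + 0"
    then have "(replicate (length ms) 0, a) \<in> exponents (length ms) 0 \<times> monoms s"
      by (simp add: exponents_def monoms_def sum_list_replicate)
    then have "power_list ms (replicate (length ms) 0) * single a 1 \<in> ?T 0"
      by (rule rev_image_eqI) simp
    then show "single a 1 \<in> vs.span (I \<union> ?T 0)"
      by (intro vs.span_base UnI2) (simp only: power_list_replicate_0 mult_1_left)
  qed
next
  case (Suc k)
  let ?K = "vs.span (I \<union> ?T (Suc k))"
  have IK: "I \<subseteq> ?K" by (rule order_trans[OF Un_upper1 vs.span_superset])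
  have step: "p * v \<in> ?K" if p: "p \<in> forms (s + k)" and v: "v \<in> set ms" for p v
  proof -
    obtain j where j: "j < length ms" "v = ms ! j" using v by (auto simp: in_set_conv_nth)
    have "vs.subspace {p. p * v \<in> ?K}"
    proof (rule vs.subspaceI)
      show "0 \<in> {p. p * v \<in> ?K}" by (simp add: vs.span_zero)
      show "x + y \<in> {p. p * v \<in> ?K}" if "x \<in> {p. p * v \<in> ?K}" "y \<in> {p. p * v \<in> ?K}" for x y
        using that unfolding mem_Collect_eq distrib_right by (rule vs.span_add)
      show "single 0 c * x \<in> {p. p * v \<in> ?K}" if "x \<in> {p. p * v \<in> ?K}" for c x
        using that unfolding mem_Collect_eq mult.assoc by (rule vs.span_scale)
    qed
    moreover have "I \<union> ?T k \<subseteq> {p. p * v \<in> ?K}"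
    proof
      fix q assume "q \<in> I \<union> ?T k"
      then show "q \<in> {p. p * v \<in> ?K}"
      proof
        assume "q \<in> I"
        then have "q * v \<in> I" using idl.subspace_scale[OF I(1), of q v] by (simp only: mult.commute)
        then show ?thesis using IK by blast
      next
        assume "q \<in> ?T k"
        then obtain \<beta> a where q: "q = power_list ms \<beta> * single a 1"
          and \<beta>: "length \<beta> = length ms" "sum_list \<beta> = k" and a: "a \<in> monoms s"
          by (auto simp: exponents_def)
        \<comment> \<open>Multiplying by \<open>ms ! j\<close> raises the exponent at
          \<open>j\<close> by one, which leads from \<open>?T k\<close> to
          \<open>?T (Suc k)\<close>.\<close>
        let ?\<beta> = "\<beta>[j := Suc (\<beta> ! j)]"
        have "sum_list ?\<beta> = Suc k"
          using j \<beta> member_le_sum_list[of "\<beta> ! j" \<beta>] by (simp add: sum_list_update)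
        then have "(?\<beta>, a) \<in> exponents (length ms) (Suc k) \<times> monoms s"
          using \<beta>(1) a by (simp add: exponents_def)
        then have "power_list ms ?\<beta> * single a 1 \<in> ?T (Suc k)"
          by (rule rev_image_eqI) simp
        moreover have "power_list ms ?\<beta> * single a 1 = q * v"
          unfolding power_list_update[OF j(1) \<beta>(1)] q j(2) by (simp only: mult_ac)
        ultimately have "q * v \<in> ?T (Suc k)" by (simp only:)
        then show ?thesis by (intro CollectI vs.span_base UnI2)
      qed
    qed
    ultimately have "vs.span (I \<union> ?T k) \<subseteq> {p. p * v \<in> ?K}" by (rule vs.span_minimal[rotated])
    then show ?thesis using Suc p by blast
  qed
  show ?case
  proof
    fix f :: "('m, 'k) mpoly" assume f: "f \<in> forms (s + Suc k)"
    have "f \<in> idl.span (I \<union> set ms)" by (rule subsetD[OF sub[OF le_add1] f])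
    then have "hcomp (Suc (s + k)) f \<in>
        vs.span (I \<union> {p * v | p v. p \<in> forms (s + k) \<and> v \<in> set ms})"
      by (rule hcomp_span_Un_linear_forms[OF I ms])
    moreover have "hcomp (Suc (s + k)) f = f" using f by (simp add: hcomp_form)
    ultimately have "f \<in> vs.span (I \<union> {p * v | p v. p \<in> forms (s + k) \<and> v \<in> set ms})"
      by (simp only:)
    moreover have "vs.span (I \<union> {p * v | p v. p \<in> forms (s + k) \<and> v \<in> set ms}) \<subseteq> ?K"
      using IK step by (intro vs.span_minimal vs.subspace_span) blast
    ultimately show "f \<in> ?K" by (rule rev_subsetD)
  qed
qed

text \<open>With fewer forms in \<open>B\<close>, some degree of the quotient by the initial ideal
  is too small for the power products of \<open>L\<close> to be independent. A dependence among them
  yields a smaller reducing set inside the ideal of \<open>L\<close>, against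
  \<open>min\<close>.\<close>

lemma card_generators_le:
  fixes I :: "('m::finite, 'k::field) mpoly set"
  assumes inf: "infinite (UNIV :: 'k set)" and I: "idl.subspace I" "graded I"
    and L: "finite L" "L \<subseteq> forms 1" "reduces (idl.span (initial_ideal lam I \<union> L))"
    and min: "\<And>M. finite M \<Longrightarrow> M \<subseteq> forms 1 \<Longrightarrow> M \<subseteq> idl.span L \<Longrightarrow>
      reduces (idl.span (initial_ideal lam I \<union> M)) \<Longrightarrow> card L \<le> card M"
    and B: "finite B" "B \<subseteq> forms 1" "reduces (idl.span (I \<union> B))"
  shows "card L \<le> card B"
proof (rule ccontr)
  assume "\<not> card L \<le> card B"
  then obtain e where e: "card L = Suc e" "card B \<le> e" by (cases "card L") auto
  obtain bs where bs: "set bs = B" "length bs = card B"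
    using finite_distinct_list[OF B(1)] distinct_card by metis
  \<comment> \<open>Padding with zeros makes the length exactly \<open>card L - 1\<close> and leaves
    the generated ideal unchanged.\<close>
  define ms where "ms = bs @ replicate (e - card B) 0"
  have len: "length ms = e" using bs e by (simp add: ms_def)
  have msB: "set ms \<subseteq> insert 0 B" and Bms: "B \<subseteq> set ms"
    using bs by (auto simp: ms_def)
  have ms1: "set ms \<subseteq> forms 1" using msB B(2) by auto
  obtain s where "\<And>n. n \<ge> s \<Longrightarrow> forms n \<subseteq> idl.span (I \<union> B)"
    using B(3) unfolding reduces_def by blast
  moreover have "idl.span (I \<union> B) \<subseteq> idl.span (I \<union> set ms)"
    using Bms by (intro idl.span_mono) blast
  ultimately have sub: "forms n \<subseteq> idl.span (I \<union> set ms)" if "n \<ge> s" for n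
    using that by (meson order_trans)
  \<comment> \<open>The constant factor is the number of monomials of degree \<open>s\<close>, the
    cofactors of the power products.\<close>
  obtain n where n: "n > s"
    "card (monoms s :: ('m \<Rightarrow>\<^sub>0 nat) set) * card (exponents e (n - s)) < card (exponents (Suc e) n)"
    using card_exponents_growth by blast
  define T where "T = (\<lambda>(\<beta>, a). power_list ms \<beta> * single a 1) `
    (exponents e (n - s) \<times> (monoms s :: ('m \<Rightarrow>\<^sub>0 nat) set))"
  have finT: "finite T" by (simp add: T_def)
  have "card T \<le> card (exponents e (n - s) \<times> (monoms s :: ('m \<Rightarrow>\<^sub>0 nat) set))"
    unfolding T_def by (rule card_image_le) simp
  then have cardT: "card T < card (exponents (Suc e) n)"
    using n(2) by (simp add: card_cartesian_product mult.commute)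
  have "forms (s + (n - s)) \<subseteq> vs.span (I \<union> T)"
    unfolding T_def len[symmetric] by (rule forms_subset_span_power_products[OF I ms1]) (rule sub)
  then have "forms n \<subseteq> vs.span (I \<union> T)" using n(1) by simp
  from standard_monomials[OF I(1) finT this]
  obtain S where S: "S \<subseteq> monoms n" "card S \<le> card T"
    "forms n \<subseteq> vs.span (initial_ideal lam I \<union> (\<lambda>a. single a 1) ` S)" by blast
  define J where "J = initial_ideal lam I"
  have J: "idl.subspace J" unfolding J_def by (rule subspace_initial_ideal)
  have finS: "finite S" using S(1) finite_monoms by (rule finite_subset)
  obtain ls where ls: "set ls = L" "length ls = Suc e"
    using finite_distinct_list[OF L(1)] distinct_card e(1) by metis
  have ls1: "set ls \<subseteq> forms 1" using L(2) ls(1) by simp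
  have less: "card ((\<lambda>a. single a (1 :: 'k)) ` S) < card (exponents (Suc e) n)"
    using card_image_le[OF finS, of "\<lambda>a. single a (1 :: 'k)"] S(2) cardT by linarith
  have "power_list ls \<beta> \<in> vs.span (J \<union> (\<lambda>a. single a 1) ` S)" if "\<beta> \<in> exponents (Suc e) n" for \<beta>
  proof -
    have "homogeneous_of_degree n (power_list ls \<beta>)"
      using forms_power_list[OF ls1, of \<beta>] that ls(2) by (simp add: exponents_def)
    then show ?thesis using S(3) unfolding J_def by blast
  qed
  from vs.dependent_modulo_subspace[where b = "power_list ls", OF finite_imageI[OF finS]
      finite_exponents less vs_subspace_of_ideal[OF J] this]
  obtain c where c: "\<exists>\<beta>\<in>exponents (length ls) n. c \<beta> \<noteq> 0"
    "(\<Sum>\<beta>\<in>exponents (length ls) n. single 0 (c \<beta>) * power_list ls \<beta>) \<in> J"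
    unfolding ls(2) by blast
  have red: "reduces (idl.span (J \<union> set ls))" using L(3) ls(1) by (simp add: J_def)
  have "n > 0" using n(1) by simp
  from smaller_reduction_of_dependent[OF inf J ls1 red this c]
  obtain M where M: "finite M" "card M < card L" "M \<subseteq> forms 1" "M \<subseteq> idl.span L"
    "reduces (idl.span (J \<union> M))"
    unfolding ls e(1) by blast
  then show False using min[of M] unfolding J_def by linarith
qed

text \<open>A reduction inside that of \<open>V\<close> is generated modulo \<open>I\<close> by
  linear combinations of \<open>V\<close>. A basis \<open>B\<close> of the combinations it contains
  is itself a reducing set, so it has at least \<open>card V\<close> elements and its span contains
  all of \<open>V\<close>.\<close>

lemma minimally_reducesI_card:
  fixes I :: "('m::finite, 'k::field) mpoly set"
  assumes I: "idl.subspace I" "graded I" and V: "finite V" "V \<subseteq> forms 1" "reduces (idl.span (I \<union> V))"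
    and min: "\<And>B. finite B \<Longrightarrow> B \<subseteq> forms 1 \<Longrightarrow> reduces (idl.span (I \<union> B)) \<Longrightarrow> card V \<le> card B"
  shows "minimally_reduces I V"
proof -
  have "idl.span (I \<union> V') = idl.span (I \<union> V)"
    if V': "V' \<subseteq> forms 1" "reduces (idl.span (I \<union> V'))" "idl.span (I \<union> V') \<subseteq> idl.span (I \<union> V)" for V'
  proof -
    define K where "K = idl.span (I \<union> V')"
    have K: "idl.subspace K" and IK: "I \<subseteq> K" and V'K: "V' \<subseteq> K"
      using idl.span_superset[of "I \<union> V'"] by (auto simp: K_def)
    obtain B where B: "B \<subseteq> vs.span V \<inter> K" "vs.independent B" "vs.span V \<inter> K \<subseteq> vs.span B"
      by (rule vs.maximal_independent_subset)
    have "vs.span V \<subseteq> forms 1" using V(2) by (rule vs.span_minimal[OF _ subspace_forms])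
    then have B1: "B \<subseteq> forms 1" using B(1) by blast
    have finB: "finite B" by (rule independent_linear_forms_finite[OF B(2) B1])
    have "V' \<subseteq> idl.span (I \<union> B)"
    proof
      fix v assume v: "v \<in> V'"
      then have "v \<in> idl.span (I \<union> V)" using V'(3) V'K unfolding K_def by blast
      \<comment> \<open>In degree one the cofactors of \<open>V\<close> are constants, so
        \<open>v\<close> is an element of \<open>I\<close> plus a linear combination of
        \<open>V\<close>.\<close>
      then have "hcomp (Suc 0) v \<in> vs.span (I \<union> {p * w | p w. p \<in> forms 0 \<and> w \<in> V})"
        by (rule hcomp_span_Un_linear_forms[OF I V(2)])
      moreover have "hcomp (Suc 0) v = v" using v V'(1) hcomp_form[of "Suc 0" v "Suc 0"] by auto
      moreover have "{p * w | p w. p \<in> forms 0 \<and> w \<in> V} \<subseteq> vs.span V"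
      proof clarify
        fix p w :: "('m, 'k) mpoly" assume p: "homogeneous_of_degree 0 p" and w: "w \<in> V"
        have "keys p \<subseteq> {0}"
          using p by (auto simp: homogeneous_of_degree_def monom_degree_def intro: poly_mapping_eqI)
        then have p0: "p = single 0 (lookup p 0)"
          by (intro poly_mapping_eqI) (auto simp: lookup_single when_def in_keys_iff)
        have "single 0 (lookup p 0) * w \<in> vs.span V"
          using w by (intro vs.span_scale vs.span_base)
        then show "p * w \<in> vs.span V" by (simp only: p0[symmetric])
      qed
      then have "vs.span (I \<union> {p * w | p w. p \<in> forms 0 \<and> w \<in> V}) \<subseteq> vs.span (I \<union> vs.span V)"
        by (intro vs.span_mono Un_mono subset_refl)
      ultimately have "v \<in> vs.span (I \<union> vs.span V)" by auto
      then obtain x y where xy: "v = x + y" "x \<in> I" "y \<in> vs.span V"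
        unfolding vs.span_Un vs.span_span
          vs.span_eq_iff[THEN iffD2, OF vs_subspace_of_ideal[OF I(1)]] by blast
      have "v - x \<in> K" using v V'K IK xy(2) by (intro idl.subspace_diff[OF K]) auto
      then have "y \<in> vs.span B" using B(3) xy by auto
      then have "y \<in> idl.span (I \<union> B)"
        using vs_span_subset_idl_span[of B] idl.span_mono[of B "I \<union> B"] by blast
      moreover have "x \<in> idl.span (I \<union> B)" using xy(2) by (intro idl.span_base) blast
      ultimately show "v \<in> idl.span (I \<union> B)" unfolding xy(1) by (intro idl.span_add)
    qed
    then have "I \<union> V' \<subseteq> idl.span (I \<union> B)"
      using idl.span_superset[of "I \<union> B"] by blast
    then have "K \<subseteq> idl.span (I \<union> B)"
      unfolding K_def by (rule idl.span_minimal) (rule idl.subspace_span)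
    then have "reduces (idl.span (I \<union> B))"
      using V'(2) unfolding K_def by (rule reduces_mono[rotated])
    then have card: "card V \<le> card B" by (rule min[OF finB B1])
    have "B \<subseteq> vs.span V" using B(1) by blast
    then have "V \<subseteq> vs.span B" by (rule vs.subset_span_of_card_le[OF B(2) _ V(1) card])
    moreover have "vs.span B \<subseteq> K"
      using B(1) by (intro vs.span_minimal vs_subspace_of_ideal[OF K]) blast
    ultimately have "I \<union> V \<subseteq> K" using IK by blast
    then have "idl.span (I \<union> V) \<subseteq> K" using K by (rule idl.span_minimal)
    then show ?thesis using V'(3) unfolding K_def by (rule equalityI[rotated])
  qed
  then show ?thesis using V unfolding minimally_reduces_def by blast
qed

theorem theorem3p3:
  fixes I :: "('m::finite, 'k::field) mpoly set"
    and lam :: "int ^ 'm \<Rightarrow> int"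
  assumes "infinite (UNIV :: 'k set)"
    and "homogeneous_ideal I"
    and "I \<noteq> carrier mpoly_ring"
    and "Modules.module_hom (*s) (*) lam"
  shows "quotient_reduction_number I \<le> quotient_reduction_number (initial_ideal lam I)"
proof -
  note I = homogeneous_ideal_graded[OF assms(2)]
  define J where "J = initial_ideal lam I"
  have J: "idl.subspace J" unfolding J_def by (rule subspace_initial_ideal)
  define R where "R = {LEAST n. forms (n + 1) \<subseteq> idl.span (J \<union> V) | V. minimally_reduces J V}"
  obtain V0 where "minimally_reduces J V0" using exists_minimal_reduction[of J] by blast
  then have "R \<noteq> {}" unfolding R_def by blast
  \<comment> \<open>The infimum of a nonempty set of natural numbers is attained, so some
    \<open>V\<close> realizes the reduction number.\<close>
  then have "Inf R \<in> R" by (rule Inf_nat_def1)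
  then obtain V where V: "minimally_reduces J V"
    and r: "Inf R = (LEAST n. forms (n + 1) \<subseteq> idl.span (J \<union> V))"
    unfolding R_def by blast
  define r where "r = Inf R"
  have red: "reduces (idl.span (J \<union> V))" using V by (simp add: minimally_reduces_def)
  \<comment> \<open>Some degree of the form \<open>N + 1\<close> is contained, so
    \<open>LEAST\<close> has a witness and its property holds at \<open>r\<close>.\<close>
  then obtain N where "forms (N + 1) \<subseteq> idl.span (J \<union> V)"
    unfolding reduces_def using le_add1 by blast
  then have "forms (r + 1) \<subseteq> idl.span (J \<union> V)"
    unfolding r_def r by (rule LeastI)
  moreover obtain L where L: "finite L" "L \<subseteq> forms 1" "idl.span (J \<union> L) = idl.span (J \<union> V)"
    and min: "\<And>M. finite M \<Longrightarrow> M \<subseteq> forms 1 \<Longrightarrow> M \<subseteq> idl.span L \<Longrightarrow>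
      reduces (idl.span (J \<union> M)) \<Longrightarrow> card L \<le> card M"
    using minimal_generators_of_minimal_reduction[OF V] by blast
  ultimately have "forms (r + 1) \<subseteq> idl.span (initial_ideal lam I \<union> L)" by (simp add: J_def)
  from forms_subset_torus[OF assms(4) I(1) assms(1) I(2) L(2) this]
  obtain t where t: "t \<noteq> 0"
    and sub: "forms (r + 1) \<subseteq> idl.span (I \<union> twist (\<lambda>c. c) (weight_power lam t) ` L)" by blast
  define U where "U = twist (\<lambda>c. c) (weight_power lam t) ` L"
  have U: "finite U" "U \<subseteq> forms 1"
    using L(1) torus_linear_forms[OF assms(4) I(1) L(2) t] by (simp_all add: U_def)
  have "reduces (idl.span (I \<union> U))"
    by (rule reducesI[OF idl.subspace_span]) (use sub in \<open>simp only: U_def\<close>)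
  moreover have "card U \<le> card B"
    if "finite B" "B \<subseteq> forms 1" "reduces (idl.span (I \<union> B))" for B
  proof -
    \<comment> \<open>Passing to the image does not increase the number of forms, and no reducing
      set for \<open>I\<close> has fewer than \<open>card L\<close> of them.\<close>
    have "card U \<le> card L" unfolding U_def by (rule card_image_le[OF L(1)])
    also have "\<dots> \<le> card B"
      by (rule card_generators_le[OF assms(1) I L(1,2) _ _ that, of lam])
        (use red L(3) min in \<open>simp_all add: J_def\<close>)
    finally show ?thesis .
  qed
  ultimately have "minimally_reduces I U" by (rule minimally_reducesI_card[OF I U])
  \<comment> \<open>\<open>U\<close> is one competitor in the infimum, and its reduction number is
    at most \<open>r\<close> because all forms of degree \<open>r + 1\<close> are contained.\<close>
  then have "Inf {LEAST n. forms (n + 1) \<subseteq> idl.span (I \<union> V) | V. minimally_reduces I V}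
      \<le> (LEAST n. forms (n + 1) \<subseteq> idl.span (I \<union> U))"
    by (intro wellorder_Inf_le1) blast
  also have "\<dots> \<le> r" by (rule Least_le) (use sub in \<open>simp only: U_def\<close>)
  also have "r = quotient_reduction_number (initial_ideal lam I)"
    using quotient_reduction_number_eq[OF J] by (simp only: r_def R_def J_def)
  finally show ?thesis unfolding quotient_reduction_number_eq[OF I(1)] .
qed

end
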